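(* There exist infinitely many parameter quadruples $(k,j,n,h)$ for which $v(k,j,n,h)\ne v_X(k,j,n,h)$; equivalently, for infinitely many parameter quadruples the hider in Alpern's Caching Game $G(k,j,n,h)$ has no optimal strategy that is extremal.
   Context: Alpern's Caching Game $G(k,j,n,h)$ ($k\ge j\ge 1$ and $n\ge 1$ integers, $h>0$ real): the hider places each of $k$ nuts into one of $n$ holes at a positive depth, so that the sum, over the non-empty holes, of the depth of the deepest nut in the hole is at most $1$ (such an arrangement is called a placement). The searcher observes nothing about the placement and digs in the holes (switching between holes at will, or digging several in parallel), with total digging at most $h$. A nut is found once its hole has been dug at least to the depth of the nut. The searching strategy is adaptive: the searcher continuously observes what he has found and where. The searcher wins if he finds at least $j$ nuts; otherwise the hider wins. Both players may use mixed strategies (only those for which winning probabilities are defined). The value $v(k,j,n,h)$ is the value of this zero-sum game with payoff the winning probability of the searcher, i.e. the common value of $\sup$ over searching strategies of $\inf$ over placements, and $\inf$ over hiding strategies of $\sup$ over pure searching strategies. A placement is extremal if the sum over non-empty holes of the depth of the deepest nut equals exactly $1$; a mixed hiding strategy is extremal if it is supported on extremal placements. $v_X(k,j,n,h)$ is the value of the same game in which the hider must use an extremal strategy. *)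

theory Defs
  imports "HOL-Probability.Probability"
begin

text \<open>
  A placement assigns to each of the nuts \<open>0, \<dots>, k - 1\<close> a pair (hole, depth), the holes being
  \<open>0, \<dots>, n - 1\<close>. The labels only serve to make placements vectors; the searcher never sees them.
\<close>

type_synonym placement = "nat \<Rightarrow> nat \<times> real"

definition total_depth :: "nat \<Rightarrow> placement \<Rightarrow> real" where
  "total_depth k P = (\<Sum>i \<in> fst ` P ` {..<k}. Max {x. (i, x) \<in> P ` {..<k}})"

definition placements :: "nat \<Rightarrow> nat \<Rightarrow> placement set" where
  "placements k n = {P \<in> {..<k} \<rightarrow>\<^sub>E {..<n} \<times> {0<..}. total_depth k P \<le> 1}"

definition extremal_placements :: "nat \<Rightarrow> nat \<Rightarrow> placement set" where
  "extremal_placements k n = {P \<in> placements k n. total_depth k P = 1}"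

definition placement_space :: "nat \<Rightarrow> nat \<Rightarrow> placement measure" where
  "placement_space k n = restrict_space (PiM {..<k} (\<lambda>_. borel)) (placements k n)"

definition found :: "nat \<Rightarrow> placement \<Rightarrow> (nat \<Rightarrow> real) \<Rightarrow> (nat \<times> real) multiset" where
  "found k P d = {#(i, x) \<in># image_mset P (mset_set {..<k}). x \<le> d i#}"

text \<open>
  A digging process: \<open>D t i\<close> is the depth of hole \<open>i\<close> at time \<open>t \<in> [0, h]\<close>. Holes may be dug in
  parallel, at total speed at most 1, so the total digging is at most \<open>h\<close>.
\<close>

definition digging :: "nat \<Rightarrow> real \<Rightarrow> (real \<Rightarrow> nat \<Rightarrow> real) \<Rightarrow> bool" where
  "digging n h D \<longleftrightarrow>
     (\<forall>i<n. D 0 i = 0) \<and>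
     (\<forall>s t. 0 \<le> s \<longrightarrow> s \<le> t \<longrightarrow> t \<le> h \<longrightarrow>
        (\<forall>i<n. D s i \<le> D t i) \<and> (\<Sum>i<n. D t i - D s i) \<le> t - s)"

text \<open>
  An adaptive pure strategy is given by the digging process \<open>S P\<close> that it produces against each
  placement \<open>P\<close>. It must be non-anticipative: if what has been found before time \<open>t\<close> (and where)
  would have been the same for \<open>Q\<close> as for \<open>P\<close>, then the holes at time \<open>t\<close> are the same for both.
\<close>

type_synonym strategy = "placement \<Rightarrow> real \<Rightarrow> nat \<Rightarrow> real"

definition strategies :: "nat \<Rightarrow> nat \<Rightarrow> real \<Rightarrow> strategy set" where
  "strategies k n h = {S.
     (\<forall>P \<in> placements k n. digging n h (S P)) \<and>
     (\<forall>P \<in> placements k n. \<forall>Q \<in> placements k n. \<forall>t \<in> {0..h}.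
        (\<forall>s \<in> {0..<t}. found k P (S P s) = found k Q (S P s)) \<longrightarrow>
        (\<forall>i<n. S P t i = S Q t i))}"

definition wins :: "nat \<Rightarrow> nat \<Rightarrow> real \<Rightarrow> strategy \<Rightarrow> placement \<Rightarrow> bool" where
  "wins k j h S P \<longleftrightarrow> j \<le> size (found k P (S P h))"

text \<open>
  Strategies are restricted to those for which winning probabilities are defined. For pure
  searching strategies this means that the set of placements they beat is Borel; for mixed ones,
  which are probability measures on pure strategies with respect to an arbitrary sigma-algebra,
  that winning is a jointly measurable event (so that the winning probability is defined, and given
  by Fubini, against every mixed hiding strategy).
\<close>

definition pure_searches :: "nat \<Rightarrow> nat \<Rightarrow> nat \<Rightarrow> real \<Rightarrow> strategy set" where
  "pure_searches k j n h =
     {S \<in> strategies k n h. {P \<in> placements k n. wins k j h S P} \<in> sets (placement_space k n)}"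

definition mixed_searches :: "nat \<Rightarrow> nat \<Rightarrow> nat \<Rightarrow> real \<Rightarrow> strategy measure set" where
  "mixed_searches k j n h = {\<nu>. prob_space \<nu> \<and> space \<nu> \<subseteq> strategies k n h \<and>
     {(S, P). S \<in> space \<nu> \<and> P \<in> placements k n \<and> wins k j h S P}
       \<in> sets (\<nu> \<Otimes>\<^sub>M placement_space k n)}"

text \<open>Mixed hiding strategies supported on a set \<open>X\<close> of placements.\<close>

definition mixed_hidings :: "nat \<Rightarrow> nat \<Rightarrow> placement set \<Rightarrow> placement measure set" where
  "mixed_hidings k n X =
     {\<mu>. prob_space \<mu> \<and> sets \<mu> = sets (placement_space k n) \<and> (AE P in \<mu>. P \<in> X)}"

definition hiding_guarantee :: "nat \<Rightarrow> nat \<Rightarrow> nat \<Rightarrow> real \<Rightarrow> placement measure \<Rightarrow> real" where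
  "hiding_guarantee k j n h \<mu> =
     (SUP S \<in> pure_searches k j n h. measure \<mu> {P \<in> placements k n. wins k j h S P})"

text \<open>
  The two expressions for the value of the game in which the hider is confined to the set \<open>X\<close>:
  \<open>X = placements k n\<close> gives the game itself, and \<open>X = extremal_placements k n\<close> the extremal game.
  The value of a game is their common value.
\<close>

definition value_sup_inf :: "nat \<Rightarrow> nat \<Rightarrow> nat \<Rightarrow> real \<Rightarrow> placement set \<Rightarrow> real" where
  "value_sup_inf k j n h X =
     (SUP \<nu> \<in> mixed_searches k j n h. INF P \<in> X. measure \<nu> {S \<in> space \<nu>. wins k j h S P})"

definition value_inf_sup :: "nat \<Rightarrow> nat \<Rightarrow> nat \<Rightarrow> real \<Rightarrow> placement set \<Rightarrow> real" where
  "value_inf_sup k j n h X = (INF \<mu> \<in> mixed_hidings k n X. hiding_guarantee k j n h \<mu>)"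

definition optimal_hiding :: "nat \<Rightarrow> nat \<Rightarrow> nat \<Rightarrow> real \<Rightarrow> placement measure \<Rightarrow> bool" where
  "optimal_hiding k j n h \<mu> \<longleftrightarrow>
     \<mu> \<in> mixed_hidings k n (placements k n) \<and>
     hiding_guarantee k j n h \<mu> = value_inf_sup k j n h (placements k n)"

end

theory Submission imports Defs begin

text \<open>
  The two values differ for \<open>k = j = 2\<close>, \<open>n = 4\<close> and every \<open>h\<close> with \<open>11/5 \<le> h < 9/4\<close>: the hider can
  hold the searcher down to \<open>11/25\<close>, but not below \<open>9/20\<close> if he is confined to extremal placements.

  For the first bound the hider uses depths in \<open>{1/4, 1/2, 3/4, 1}\<close>, some of them non-extremal, such as
  depths \<open>1/4\<close> and \<open>1/2\<close> in different holes, which keep the searcher uncertain about how deep to dig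
  after the first find. A searcher with \<open>h < 9/4\<close> can reach at most eight of the sixteen quarter
  marks, so a pure strategy amounts to a lattice path, followed until the first find, with a final
  position for each possible first find. A potential on lattice points bounds what it wins.

  For the second bound the searcher digs along one fixed path until he finds a nut, at depth \<open>x\<close> say.
  The other nut is then at depth \<open>1 - x\<close> in another hole or at depth \<open>1\<close> in the same hole, and
  the searcher chooses between two ways of spending the remaining budget with probabilities \<open>4/5\<close> and
  \<open>1/5\<close>. The holes are relabelled at random beforehand.

  Both mixed strategies have finite support, and strategies of the opponent are averaged over it.
\<close>

section \<open>Digging processes and strategies\<close>

lemma found_cong:
  assumes "P \<in> placements k n" "\<And>i. i < n \<Longrightarrow> d i = d' i"
  shows "found k P d = found k P d'"
proof -
  have "fst (P j) < n" if "j < k" for j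
    using assms(1) that by (force simp: placements_def PiE_iff)
  then show ?thesis
    unfolding found_def using assms(2)
    by (intro filter_mset_cong) (auto simp: case_prod_beta)
qed

lemma digging_mono:
  "\<lbrakk>digging n h D; 0 \<le> s; s \<le> t; t \<le> h; i < n\<rbrakk> \<Longrightarrow> D s i \<le> D t i"
  by (auto simp: digging_def)

lemma digging_sum_diff_le:
  "\<lbrakk>digging n h D; 0 \<le> s; s \<le> t; t \<le> h\<rbrakk> \<Longrightarrow> (\<Sum>i<n. D t i - D s i) \<le> t - s"
  by (simp add: digging_def)

lemma digging_sum_le:
  assumes "digging n h D" "0 \<le> t" "t \<le> h"
  shows "(\<Sum>i<n. D t i) \<le> t"
proof -
  have "(\<Sum>i<n. D t i) = (\<Sum>i<n. D t i - D 0 i)"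
    using assms(1) by (intro sum.cong) (auto simp: digging_def)
  also have "\<dots> \<le> t - 0"
    using assms unfolding digging_def by blast
  finally show ?thesis by simp
qed

lemma digging_lipschitz:
  assumes "digging n h D" "0 \<le> s" "s \<le> t" "t \<le> h" "i < n"
  shows "D t i \<le> D s i + (t - s)"
proof -
  have "D t i - D s i \<le> (\<Sum>i<n. D t i - D s i)"
    using assms by (intro member_le_sum) (auto simp: digging_def)
  also have "\<dots> \<le> t - s"
    using assms by (auto simp: digging_def)
  finally show ?thesis by simp
qed

text \<open>The value \<open>h + 1\<close> stands for a depth that is not reached by time \<open>h\<close>.\<close>

definition crossing :: "real \<Rightarrow> (real \<Rightarrow> nat \<Rightarrow> real) \<Rightarrow> nat \<Rightarrow> real \<Rightarrow> real" where
  "crossing h D i x = (if x \<le> D h i then Inf {t \<in> {0..h}. x \<le> D t i} else h + 1)"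

text \<open>Depths increase with time and are Lipschitz, so the infimum of the times at which
  \<open>x\<close> has been reached is attained and all later times qualify.\<close>

lemma crossing_iff:
  assumes D: "digging n h D" and i: "i < n" and t: "t \<in> {0..h}"
  shows "x \<le> D t i \<longleftrightarrow> crossing h D i x \<le> t"
proof (cases "x \<le> D h i")
  case True
  define A where "A = {t \<in> {0..h}. x \<le> D t i}"
  have A: "h \<in> A" "bdd_below A"
    using True t by (auto simp: A_def)
  have c: "crossing h D i x = Inf A"
    using True by (simp add: crossing_def A_def)
  have 0: "0 \<le> Inf A"
    using A by (intro cInf_greatest) (auto simp: A_def)
  have "x \<le> D (Inf A) i"
  proof (rule ccontr)
    assume "\<not> ?thesis"
    then have "Inf A < Inf A + (x - D (Inf A) i)" by simp
    then obtain s where s: "s \<in> A" "s < Inf A + (x - D (Inf A) i)"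
      using cInf_lessD[of A] A by blast
    have "Inf A \<le> s" using s A by (intro cInf_lower)
    then have "D s i \<le> D (Inf A) i + (s - Inf A)"
      using s 0 by (intro digging_lipschitz[OF D _ _ _ i]) (auto simp: A_def)
    with s show False by (simp add: A_def)
  qed
  then have "x \<le> D t i" if "Inf A \<le> t"
    using digging_mono[OF D 0 that _ i] t by force
  moreover have "Inf A \<le> t" if "x \<le> D t i"
    using that t A by (intro cInf_lower) (auto simp: A_def)
  ultimately show ?thesis unfolding c by blast
next
  case False
  then show ?thesis
    using t digging_mono[OF D _ _ _ i, of t h] by (auto simp: crossing_def)
qed

text \<open>Finitely many nuts are unfound, each strictly below the bottom of its hole. As depths
  grow at rate at most 1, the smallest gap is a time span without new finds.\<close>

lemma found_right_continuous:
  assumes D: "digging n h D" and P: "P \<in> placements k n" and t: "0 \<le> t"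
  shows "\<exists>e>0. \<forall>s. t \<le> s \<longrightarrow> s < t + e \<longrightarrow> s \<le> h \<longrightarrow> found k P (D s) = found k P (D t)"
proof -
  have n: "fst (P j) < n" if "j < k" for j
    using P that by (force simp: placements_def PiE_iff)
  \<comment> \<open>The inserted 1 keeps \<open>Min G\<close> meaningful when every nut has been
    found.\<close>
  define G where "G = insert 1 ((\<lambda>j. snd (P j) - D t (fst (P j))) ` {j \<in> {..<k}. D t (fst (P j)) < snd (P j)})"
  have G: "finite G" "\<And>g. g \<in> G \<Longrightarrow> 0 < g" by (auto simp: G_def)
  have "found k P (D s) = found k P (D t)" if "t \<le> s" "s < t + Min G" "s \<le> h" for s
    unfolding found_def
  proof (intro filter_mset_cong refl)
    fix p assume "p \<in># image_mset P (mset_set {..<k})"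
    then obtain j where j: "j < k" "p = P j" by auto
    have 1: "D s (fst p) < snd p" if "D t (fst p) < snd p"
    proof -
      have "Min G \<le> snd p - D t (fst p)"
        using G j that by (intro Min_le) (auto simp: G_def)
      moreover have "D s (fst p) \<le> D t (fst p) + (s - t)"
        using digging_lipschitz[OF D t \<open>t \<le> s\<close> \<open>s \<le> h\<close>] n j by auto
      ultimately show ?thesis using \<open>s < t + Min G\<close> by linarith
    qed
    have 2: "D t (fst p) \<le> D s (fst p)"
      using digging_mono[OF D t \<open>t \<le> s\<close> \<open>s \<le> h\<close>] n j by auto
    show "(case p of (i, x) \<Rightarrow> x \<le> D s i) = (case p of (i, x) \<Rightarrow> x \<le> D t i)"
      unfolding case_prod_beta using 1 2 by linarith
  qed
  moreover have "0 < Min G" using G by (subst Min_gr_iff) (auto simp: G_def)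
  ultimately show ?thesis by blast
qed

lemma strategy_nonanticipative:
  assumes "S \<in> strategies k n h" "P \<in> placements k n" "Q \<in> placements k n" "0 \<le> t" "t \<le> h" "i < n"
    and "\<And>s. \<lbrakk>0 \<le> s; s < t\<rbrakk> \<Longrightarrow> found k P (S P s) = found k Q (S P s)"
  shows "S P t i = S Q t i"
  using assms unfolding strategies_def mem_Collect_eq
  by (metis atLeastAtMost_iff atLeastLessThan_iff)

text \<open>Unlike in the definition of strategies, the two sides are compared along their own processes.\<close>

lemma strategy_agree:
  assumes S: "S \<in> strategies k n h" and P: "P \<in> placements k n" and Q: "Q \<in> placements k n"
    and T: "T \<le> h"
    and eq: "\<And>s. \<lbrakk>0 \<le> s; s < T\<rbrakk> \<Longrightarrow> found k P (S P s) = found k Q (S Q s)"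
    and t: "0 \<le> t" "t \<le> T" and i: "i < n"
  shows "S P t i = S Q t i"
proof -
  have dig: "digging n h (S P)"
    using S P unfolding strategies_def by blast
  note na = strategy_nonanticipative[OF S P Q]
  \<comment> \<open>Times at which the placements look different along the single process
    \<open>S P\<close>, which is the comparison that non-anticipation uses.\<close>
  define B where "B = {s. 0 \<le> s \<and> s < T \<and> found k P (S P s) \<noteq> found k Q (S P s)}"
  have bdd: "bdd_below B" by (auto simp: B_def intro!: bdd_belowI[of _ 0])
  have "B = {}"
  proof (rule ccontr)
    assume ne: "B \<noteq> {}"
    have 0: "0 \<le> Inf B"
      using ne by (intro cInf_greatest) (auto simp: B_def)
    have IT: "Inf B < T"
    proof -
      obtain b where "b \<in> B" using ne by blast
      then have "Inf B \<le> b" "b < T" using bdd by (auto intro: cInf_lower simp: B_def)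
      then show ?thesis by simp
    qed
    have "S P (Inf B) i = S Q (Inf B) i" if "i < n" for i
    proof (rule na[OF 0 _ that])
      fix s assume "0 \<le> s" "s < Inf B"
      then have "s \<notin> B" using bdd by (meson cInf_lower not_le)
      then show "found k P (S P s) = found k Q (S P s)"
        using \<open>0 \<le> s\<close> \<open>s < Inf B\<close> IT by (auto simp: B_def)
    qed (use IT T in auto)
    then have "found k Q (S P (Inf B)) = found k Q (S Q (Inf B))"
      by (rule found_cong[OF Q])
    then have eqI: "found k P (S P (Inf B)) = found k Q (S P (Inf B))"
      using eq[OF 0 IT] by simp
    \<comment> \<open>Right continuity extends the equality at \<open>Inf B\<close> to a short
      interval after it, although \<open>B\<close> has elements arbitrarily close to its
      infimum.\<close>
    obtain e1 where e1: "e1 > 0"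
      "\<And>s. \<lbrakk>Inf B \<le> s; s < Inf B + e1; s \<le> h\<rbrakk> \<Longrightarrow> found k P (S P s) = found k P (S P (Inf B))"
      using found_right_continuous[OF dig P 0] by blast
    obtain e2 where e2: "e2 > 0"
      "\<And>s. \<lbrakk>Inf B \<le> s; s < Inf B + e2; s \<le> h\<rbrakk> \<Longrightarrow> found k Q (S P s) = found k Q (S P (Inf B))"
      using found_right_continuous[OF dig Q 0] by blast
    have "Inf B < Inf B + min e1 e2" using e1 e2 by simp
    then obtain b where b: "b \<in> B" "b < Inf B + min e1 e2"
      using ne by (meson cInf_lessD)
    moreover have "Inf B \<le> b" using b bdd by (intro cInf_lower)
    moreover have "b \<le> h" using b T by (auto simp: B_def)
    ultimately show False
      using e1(2)[of b] e2(2)[of b] eqI by (auto simp: B_def)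
  qed
  then show ?thesis
    using t T i by (intro na) (auto simp: B_def)
qed

lemma crossing_range: "0 \<le> h \<Longrightarrow> crossing h D i x \<in> {0..h} \<union> {h + 1}"
proof -
  assume h: "0 \<le> h"
  have "Inf {t \<in> {0..h}. x \<le> D t i} \<in> {0..h}" if "x \<le> D h i"
  proof -
    have "Inf {t \<in> {0..h}. x \<le> D t i} \<le> h"
      using that h by (intro cInf_lower bdd_belowI[of _ 0]) auto
    moreover have "0 \<le> Inf {t \<in> {0..h}. x \<le> D t i}"
      using that h by (intro cInf_greatest) auto
    ultimately show ?thesis by simp
  qed
  then show ?thesis by (auto simp: crossing_def)
qed

section \<open>Two nuts\<close>

lemma found_two:
  "found 2 P d = (if snd (P 0) \<le> d (fst (P 0)) then {#P 0#} else {#})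
    + (if snd (P 1) \<le> d (fst (P 1)) then {#P 1#} else {#})"
proof -
  have "mset_set {..<2::nat} = {#0, 1#}"
    by (simp add: numeral_2_eq_2 lessThan_Suc)
  then show ?thesis by (auto simp: found_def case_prod_beta)
qed

lemma wins_two:
  "wins 2 2 h S P \<longleftrightarrow> snd (P 0) \<le> S P h (fst (P 0)) \<and> snd (P 1) \<le> S P h (fst (P 1))"
  by (auto simp: wins_def found_two)

lemma total_depth_two:
  "total_depth 2 P =
    (if fst (P 0) = fst (P 1) then max (snd (P 0)) (snd (P 1)) else snd (P 0) + snd (P 1))"
proof -
  have im: "P ` {..<2} = {P 0, P 1}"
    by (auto simp: numeral_2_eq_2 lessThan_Suc)
  have "{x. (i, x) \<in> {P 0, P 1}} = (if fst (P 0) = i then {snd (P 0)} else {}) \<union> (if fst (P 1) = i then {snd (P 1)} else {})" for i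
    by (auto simp: prod_eq_iff)
  then show ?thesis
    unfolding total_depth_def im by (auto simp: max.commute)
qed

lemma placements_two_iff:
  "P \<in> placements 2 n \<longleftrightarrow> P \<in> extensional {..<2} \<and> fst (P 0) < n \<and> fst (P 1) < n \<and>
    0 < snd (P 0) \<and> 0 < snd (P 1) \<and> total_depth 2 P \<le> 1"
proof -
  have "(\<forall>j\<in>{..<2}. Q j) \<longleftrightarrow> Q 0 \<and> Q (1::nat)" for Q
    by (auto simp: numeral_2_eq_2 less_Suc_eq)
  then show ?thesis
    by (auto simp: placements_def PiE_iff mem_Times_iff)
qed

section \<open>A hiding strategy on the quarter grid\<close>

text \<open>
  The hider puts both nuts at multiples of \<open>1/4\<close>; \<open>weight_same a b\<close> and \<open>weight_apart a b\<close> are the weights of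
  the depths \<open>a/4\<close> and \<open>b/4\<close> in one hole and in two holes. They solve the linear program of the
  game restricted to this grid. The weights on depths with \<open>a + b = 3\<close> in two holes and on \<open>{2, 3}\<close>
  in one hole are those of the non-extremal placements.
\<close>

definition weight_same :: "nat \<Rightarrow> nat \<Rightarrow> nat" where
  "weight_same a b = (if a = b then 0 else if min a b = 1 then (if max a b = 4 then 2 else 0) else 1)"

definition weight_apart :: "nat \<Rightarrow> nat \<Rightarrow> nat" where
  "weight_apart a b = (if a + b = 3 \<or> a + b = 4 then 1 else 0)"

text \<open>
  The weight that can still be won when nothing has been found and the holes have been dug to the
  grid depths \<open>d l\<close>, as computed by dynamic programming. Here \<open>s\<close> is the sum of the \<open>d l\<close>, and \<open>q\<close>, the
  sum of the \<open>2 ^ d l\<close>, only serves to tell the multisets of depths with the same sum apart.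
\<close>

definition potential :: "nat \<Rightarrow> nat \<Rightarrow> nat" where
  "potential s q =
     (if s = 0 then 22 else if s = 1 then 18
      else if s = 2 then (if q = 6 then 14 else 12)
      else if s = 3 then (if q = 7 then 10 else if q = 8 then 9 else 7)
      else if s = 4 then (if q \<le> 9 then 6 else 5)
      else if s = 5 then (if q = 14 then 2 else 3)
      else if s = 6 then (if q = 18 then 0 else 1) else 0)"

text \<open>
  The sum is over a list for the sake of rewriting with the code equations in \<open>gain_potential_list\<close>.
\<close>

definition gain :: "(nat \<Rightarrow> nat \<Rightarrow> nat) \<Rightarrow> nat \<Rightarrow> nat \<Rightarrow> nat \<Rightarrow> nat" where
  "gain f a x e = (\<Sum>b\<leftarrow>[Suc x..<Suc e]. f a b)"

lemma gain_eq_sum: "gain f a x e = (\<Sum>b\<in>{x<..e}. f a b)"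
proof -
  have "set [Suc x..<Suc e] = {x<..e}"
    by (simp only: set_upt atLeastLessThanSuc_atLeastAtMost atLeastSucAtMost_greaterThanAtMost)
  then show ?thesis
    unfolding gain_def using sum_list_distinct_conv_sum_set[of "[Suc x..<Suc e]" "f a"]
    by (simp only: distinct_upt)
qed

text \<open>A Bellman inequality: the path advances one hole from \<open>a - 1\<close> to
  \<open>a\<close>, a nut turns up there, and the gains are the weights of the partners between the
  current depths and the final depths \<open>p\<close>, \<open>e\<close>, \<open>f\<close>,
  \<open>g\<close>. The range is finite, so evaluation decides it.\<close>

lemma gain_potential_list:
  "\<forall>a\<in>set [1..<5]. \<forall>x\<in>set [0..<5]. \<forall>y\<in>set [0..<5]. \<forall>z\<in>set [0..<5].
   \<forall>p\<in>set [a..<5]. \<forall>e\<in>set [x..<5]. \<forall>f\<in>set [y..<5]. \<forall>g\<in>set [z..<5].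
     p + e + f + g \<le> 8 \<longrightarrow>
     gain weight_same a a p + gain weight_apart a x e + gain weight_apart a y f + gain weight_apart a z g
       + potential (a + x + y + z) (2 ^ a + 2 ^ x + 2 ^ y + 2 ^ z)
     \<le> potential (a - 1 + x + y + z) (2 ^ (a - 1) + 2 ^ x + 2 ^ y + 2 ^ z)"
  by code_simp

lemma gain_potential:
  assumes "1 \<le> a" "a \<le> p" "x \<le> e" "y \<le> f" "z \<le> g" "p \<le> 4" "e \<le> 4" "f \<le> 4" "g \<le> 4" "p + e + f + g \<le> 8"
  shows "gain weight_same a a p + gain weight_apart a x e + gain weight_apart a y f + gain weight_apart a z g
       + potential (a + x + y + z) (2 ^ a + 2 ^ x + 2 ^ y + 2 ^ z)
     \<le> potential (a - 1 + x + y + z) (2 ^ (a - 1) + 2 ^ x + 2 ^ y + 2 ^ z)"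
  using assms
  by (intro gain_potential_list[rule_format]) auto

definition mark_weight :: "nat \<times> nat \<Rightarrow> nat \<times> nat \<Rightarrow> nat" where
  "mark_weight m m' =
     (if fst m = fst m' then weight_same (snd m) (snd m') else weight_apart (snd m) (snd m'))"

definition marks :: "(nat \<times> nat) set" where
  "marks = {..<4} \<times> {1..4}"

lemma finite_marks [simp]: "finite marks"
  by (simp add: marks_def)

lemma mark_weight_commute: "mark_weight m m' = mark_weight m' m"
  by (auto simp: mark_weight_def weight_same_def weight_apart_def min.commute max.commute add.commute)

lemma mark_weight_self [simp]: "mark_weight m m = 0"
  by (simp add: mark_weight_def weight_same_def)

definition grid_potential :: "(nat \<Rightarrow> nat) \<Rightarrow> nat" where
  "grid_potential d = potential (\<Sum>l<4. d l) (\<Sum>l<4. 2 ^ d l)"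

lemma sum_lessThan_4:
  fixes F :: "nat \<Rightarrow> 'a :: comm_monoid_add"
  shows "(\<Sum>l<4. F l) = F 0 + F 1 + F 2 + F 3"
  by (simp add: eval_nat_numeral)

lemma gain_grid_potential:
  assumes i: "i < 4" and d': "d' = d(i := Suc (d i))"
    and e: "\<And>l. l < 4 \<Longrightarrow> d' l \<le> e l" "\<And>l. l < 4 \<Longrightarrow> e l \<le> 4" "(\<Sum>l<4. e l) \<le> 8"
  shows "(\<Sum>l<4. \<Sum>b\<in>{d' l<..e l}. mark_weight (i, d' i) (l, b)) + grid_potential d' \<le> grid_potential d"
proof -
  define N where "N = (\<lambda>l. gain weight_apart (d' i) (d' l) (e l))"
  have s: "(\<Sum>b\<in>{d' l<..e l}. mark_weight (i, d' i) (l, b))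
      = (if l = i then gain weight_same (d' i) (d' i) (e i) else N l)" for l
    by (auto simp: mark_weight_def gain_eq_sum N_def)
  have b: "d' 0 \<le> e 0" "d' 1 \<le> e 1" "d' 2 \<le> e 2" "d' 3 \<le> e 3"
    "e 0 \<le> 4" "e 1 \<le> 4" "e 2 \<le> 4" "e 3 \<le> 4" "e 0 + e 1 + e 2 + e 3 \<le> 8"
    using e by (simp_all add: sum_lessThan_4)
  \<comment> \<open>The potential depends on symmetric sums only, so the advanced hole may take the
    first slot.\<close>
  consider "i = 0" | "i = 1" | "i = 2" | "i = 3" using i by linarith
  then show ?thesis
  proof cases
    case 1
    show ?thesis
      using gain_potential[of "d' 0" "e 0" "d' 1" "e 1" "d' 2" "e 2" "d' 3" "e 3"] b
      unfolding grid_potential_def sum_lessThan_4 s N_def by (simp add: 1 d')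
  next
    case 2
    show ?thesis
      using gain_potential[of "d' 1" "e 1" "d' 0" "e 0" "d' 2" "e 2" "d' 3" "e 3"] b
      unfolding grid_potential_def sum_lessThan_4 s N_def by (simp add: 2 d' ac_simps)
  next
    case 3
    show ?thesis
      using gain_potential[of "d' 2" "e 2" "d' 0" "e 0" "d' 1" "e 1" "d' 3" "e 3"] b
      unfolding grid_potential_def sum_lessThan_4 s N_def by (simp add: 3 d' ac_simps)
  next
    case 4
    show ?thesis
      using gain_potential[of "d' 3" "e 3" "d' 0" "e 0" "d' 1" "e 1" "d' 2" "e 2"] b
      unfolding grid_potential_def sum_lessThan_4 s N_def by (simp add: 4 d' ac_simps)
  qed
qed

text \<open>
  \<open>T m\<close> is the time at which the process followed until the first find reaches the mark \<open>m\<close>. The last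
  assumption expresses that once the nut at \<open>q\<close> has been found, all winning continuations are
  covered by the depths that a single process reaches, which sum up to less than \<open>9/4\<close>. Ordered pairs
  of marks are summed over, so that the total weight is \<open>100\<close> and the bound is twice the potential.
\<close>

lemma mark_weight_bound:
  fixes T :: "nat \<times> nat \<Rightarrow> real" and W :: "nat \<times> nat \<Rightarrow> nat \<times> nat \<Rightarrow> bool"
  assumes W_commute: "\<And>m m'. \<lbrakk>m \<in> marks; m' \<in> marks; mark_weight m m' > 0\<rbrakk> \<Longrightarrow> W m m' \<longleftrightarrow> W m' m"
    and W_first: "\<And>m m'. \<lbrakk>m \<in> marks; m' \<in> marks; mark_weight m m' > 0; W m m'\<rbrakk> \<Longrightarrow> T m \<le> h \<or> T m' \<le> h"
    and T_mono: "\<And>i a b. \<lbrakk>i < 4; a \<le> b\<rbrakk> \<Longrightarrow> T (i, a) \<le> T (i, b)"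
    and W_second: "\<And>q. \<lbrakk>q \<in> marks; T q \<le> h\<rbrakk> \<Longrightarrow>
      \<exists>e. (\<forall>l<4. e l \<le> 4) \<and> (\<Sum>l<4. e l) \<le> 8 \<and> (\<forall>r\<in>marks. T r \<le> T q \<longrightarrow> snd r \<le> e (fst r)) \<and>
        (\<forall>r\<in>marks. mark_weight q r > 0 \<longrightarrow> W q r \<longrightarrow> T q \<le> T r \<longrightarrow> snd r \<le> e (fst r))"
  shows "(\<Sum>m\<in>marks. \<Sum>m'\<in>marks. if W m m' then mark_weight m m' else 0) \<le> 44"
proof -
  define v where "v m m' = (if W m m' then mark_weight m m' else 0)" for m m'
  define out where "out d = {r \<in> marks. d (fst r) < snd r}" for d :: "nat \<Rightarrow> nat"
  have fin [simp]: "finite (out d)" for d by (simp add: out_def)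
  have v_commute: "v m m' = v m' m" if "m \<in> marks" "m' \<in> marks" for m m'
    using W_commute[OF that] W_commute[OF that(2,1)] mark_weight_commute[of m m'] by (auto simp: v_def)
  \<comment> \<open>The second premise says that \<open>d\<close> is a state of the path: no
    remaining mark is reached before a mark already passed. Ordered pairs cause the factor
    2.\<close>
  have claim: "(\<Sum>m\<in>out d. \<Sum>m'\<in>out d. v m m') \<le> 2 * grid_potential d"
    if "\<forall>l<4. d l \<le> 4" "\<forall>r\<in>marks - out d. \<forall>r'\<in>out d. T r \<le> T r'" for d
    using that
  proof (induction "16 - (\<Sum>l<4. d l)" arbitrary: d rule: less_induct)
    case less
    note d = less.prems
    show ?case
    proof (cases "\<exists>r\<in>out d. T r \<le> h")
      case False
      have "v m m' = 0" if "m \<in> out d" "m' \<in> out d" for m m'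
      proof (rule ccontr)
        assume "v m m' \<noteq> 0"
        then have "mark_weight m m' > 0" "W m m'" by (auto simp: v_def split: if_splits)
        moreover have "m \<in> marks" "m' \<in> marks" using that by (auto simp: out_def)
        ultimately show False using False that W_first[of m m'] by blast
      qed
      then show ?thesis by simp
    next
      case True
      then have ne: "out d \<noteq> {}" by auto
      define m where "m = arg_min_on T (out d)"
      have m: "m \<in> out d" "\<And>r. r \<in> out d \<Longrightarrow> T m \<le> T r"
        using arg_min_if_finite(1)[OF fin ne, of T] arg_min_least[OF fin ne, of _ T] by (auto simp: m_def)
      define i where "i = fst m"
      \<comment> \<open>The topmost remaining mark in the hole of \<open>m\<close> is reached no
        later than \<open>m\<close>, so it is minimal too, and passing it advances \<open>d\<close>
        by exactly one.\<close>
      define q where "q = (i, Suc (d i))"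
      define d' where "d' = d(i := Suc (d i))"
      have i: "i < 4" and q: "q \<in> out d"
        using m(1) d by (auto simp: out_def marks_def q_def i_def)
      have "T q \<le> T m"
        using T_mono[OF i, of "Suc (d i)" "snd m"] m(1) by (auto simp: q_def i_def out_def)
      then have qmin: "T q \<le> T r" if "r \<in> out d" for r
        using m(2)[OF that] by simp
      have qh: "T q \<le> h" using True qmin by force
      have out': "out d = insert q (out d')" "q \<notin> out d'"
        using q by (auto simp: out_def d'_def q_def)
      have q_marks: "q \<in> marks" using q by (auto simp: out_def)
      have d4: "\<forall>l<4. d' l \<le> 4"
        using d q by (auto simp: d'_def out_def q_def marks_def)
      have inv': "\<forall>r\<in>marks - out d'. \<forall>r'\<in>out d'. T r \<le> T r'"
        using d(2) qmin out' by auto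
      obtain e where e: "\<forall>l<4. e l \<le> 4" "(\<Sum>l<4. e l) \<le> 8"
        "\<And>r. \<lbrakk>r \<in> marks; T r \<le> T q\<rbrakk> \<Longrightarrow> snd r \<le> e (fst r)"
        "\<And>r. \<lbrakk>r \<in> marks; mark_weight q r > 0; W q r; T q \<le> T r\<rbrakk> \<Longrightarrow> snd r \<le> e (fst r)"
        using W_second[OF q_marks qh] by blast
      \<comment> \<open>By the invariant, every mark up to \<open>d'\<close> is reached by time
        \<open>T q\<close>, hence is contained in the final depths \<open>e\<close>.\<close>
      have de: "d' l \<le> e l" if l: "l < 4" for l
      proof (cases "d' l = 0")
        case False
        have "(l, d' l) \<in> marks" "(l, d' l) \<notin> out d'"
          using False l d4 by (auto simp: marks_def out_def)
        then have "T (l, d' l) \<le> T q"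
          using d(2) q out' by auto
        then show ?thesis using e(3)[of "(l, d' l)"] \<open>(l, d' l) \<in> marks\<close> by simp
      qed simp
      have "(\<Sum>r\<in>out d'. v q r) \<le> (\<Sum>r\<in>(SIGMA l:{..<4}. {d' l<..e l}). mark_weight q r)"
      proof -
        have "(\<Sum>r\<in>out d'. v q r) = (\<Sum>r\<in>out d' \<inter> (SIGMA l:{..<4}. {d' l<..e l}). v q r)"
        proof (intro sum.mono_neutral_right ballI)
          fix r assume r: "r \<in> out d' - out d' \<inter> (SIGMA l:{..<4}. {d' l<..e l})"
          show "v q r = 0"
          proof (rule ccontr)
            assume "v q r \<noteq> 0"
            then have "snd r \<le> e (fst r)"
              using r out' qmin[of r] by (intro e(4)) (auto simp: v_def out_def split: if_splits)
            then show False using r by (auto simp: out_def marks_def)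
          qed
        qed auto
        also have "\<dots> \<le> (\<Sum>r\<in>(SIGMA l:{..<4}. {d' l<..e l}). mark_weight q r)"
          by (intro order.trans[OF sum_mono sum_mono2]) (auto simp: v_def)
        finally show ?thesis .
      qed
      also have "\<dots> = (\<Sum>l<4. \<Sum>b\<in>{d' l<..e l}. mark_weight q (l, b))"
        by (simp add: sum.Sigma)
      finally have "(\<Sum>r\<in>out d'. v q r) \<le> (\<Sum>l<4. \<Sum>b\<in>{d' l<..e l}. mark_weight q (l, b))" .
      moreover have "q = (i, d' i)" by (simp add: q_def d'_def)
      ultimately have G: "(\<Sum>r\<in>out d'. v q r) + grid_potential d' \<le> grid_potential d"
        using gain_grid_potential[OF i d'_def de] e(1,2) by fastforce
      have "(\<Sum>l<4. d l) < (\<Sum>l<4. d' l)"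
        using i by (intro sum_strict_mono_ex1) (auto simp: d'_def)
      moreover have "(\<Sum>l<4. d' l) \<le> (\<Sum>l<4::nat. 4)"
        using d4 by (intro sum_mono) auto
      ultimately have IH: "(\<Sum>m\<in>out d'. \<Sum>m'\<in>out d'. v m m') \<le> 2 * grid_potential d'"
        using d4 inv' by (intro less.hyps) auto
      \<comment> \<open>The row and the column of \<open>q\<close> contribute equally, and each is
        bounded by the drop in potential.\<close>
      have "(\<Sum>m\<in>out d. \<Sum>m'\<in>out d. v m m') =
          v q q + (\<Sum>r\<in>out d'. v q r) + (\<Sum>r\<in>out d'. v r q) + (\<Sum>m\<in>out d'. \<Sum>m'\<in>out d'. v m m')"
        using out' by (simp add: sum.distrib)
      moreover have "(\<Sum>r\<in>out d'. v r q) = (\<Sum>r\<in>out d'. v q r)"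
        using q_marks by (intro sum.cong v_commute) (auto simp: out_def)
      moreover have "v q q = 0" by (simp add: v_def)
      ultimately show ?thesis using G IH by simp
    qed
  qed
  have "out (\<lambda>_. 0) = marks" by (auto simp: out_def marks_def)
  then show ?thesis
    using claim[of "\<lambda>_. 0"] by (simp add: v_def grid_potential_def potential_def)
qed

section \<open>From digging strategies to marks\<close>

definition location :: "nat \<times> nat \<Rightarrow> nat \<times> real" where
  "location m = (fst m, real (snd m) / 4)"

definition mark_placement :: "nat \<times> nat \<Rightarrow> nat \<times> nat \<Rightarrow> placement" where
  "mark_placement m m' = (\<lambda>j\<in>{..<2}. location (if j = 0 then m else m'))"

lemma mark_placement_simps [simp]:
  "mark_placement m m' 0 = location m" "mark_placement m m' (Suc 0) = location m'"
  by (simp_all add: mark_placement_def)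

lemma location_simps [simp]:
  "fst (location m) = fst m" "snd (location m) = real (snd m) / 4"
  by (simp_all add: location_def)

lemma mark_placement_in_placements:
  assumes "m \<in> marks" "m' \<in> marks" "mark_weight m m' > 0"
  shows "mark_placement m m' \<in> placements 2 4"
proof -
  have "snd m + snd m' \<le> 4" if "fst m \<noteq> fst m'"
    using assms(3) that by (auto simp: mark_weight_def weight_apart_def split: if_splits)
  then have "real (snd m) + real (snd m') \<le> 4" if "fst m \<noteq> fst m'"
    using that by (metis of_nat_add of_nat_le_iff of_nat_numeral)
  then show ?thesis
    using assms(1,2)
    by (auto simp: placements_two_iff total_depth_two marks_def mark_placement_def)
qed

text \<open>Depths are rounded down to quarters; fewer than nine quarters fit into a total below
  \<open>9 / 4\<close>.\<close>

lemma ex_grid_depth: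
  assumes D: "digging 4 h D" and t: "0 \<le> t" "t \<le> h" and h: "h < 9 / 4"
  shows "\<exists>e. (\<forall>l<4. e l \<le> (4::nat)) \<and> (\<Sum>l<4. e l) \<le> 8 \<and>
    (\<forall>l<4. \<forall>b\<le>4. real b / 4 \<le> D t l \<longrightarrow> b \<le> e l)"
proof -
  define e where "e l = Max {b. b \<le> 4 \<and> real b / 4 \<le> D t l}" for l
  have fin: "finite {b. b \<le> 4 \<and> real b / 4 \<le> D t l}" for l by simp
  have ne: "0 \<in> {b::nat. b \<le> 4 \<and> real b / 4 \<le> D t l}" if "l < 4" for l
    using digging_mono[OF D order.refl t that] D that by (simp add: digging_def)
  have e: "e l \<le> 4" "real (e l) / 4 \<le> D t l" if "l < 4" for l
    using Max_in[OF fin] ne[OF that] by (fastforce simp: e_def)+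
  have "(\<Sum>l<4. real (e l) / 4) \<le> (\<Sum>l<4. D t l)"
    using e by (intro sum_mono) auto
  also have "\<dots> \<le> t" by (rule digging_sum_le[OF D t])
  finally have "real (\<Sum>l<4. e l) < 9"
    using t h by (simp add: sum_divide_distrib[symmetric])
  then have "(\<Sum>l<4. e l) \<le> 8" by linarith
  moreover have "b \<le> e l" if "l < 4" "b \<le> 4" "real b / 4 \<le> D t l" for l b
    using that fin unfolding e_def by (intro Max_ge) auto
  ultimately show ?thesis using e by blast
qed

lemma ex_max_on:
  fixes f :: "'a \<Rightarrow> real"
  assumes "finite A" "A \<noteq> {}"
  obtains x where "x \<in> A" "\<And>y. y \<in> A \<Longrightarrow> f y \<le> f x"
proof -
  have "Max (f ` A) \<in> f ` A" using assms by (intro Max_in) auto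
  then obtain x where "x \<in> A" "f x = Max (f ` A)" by auto
  with assms that show ?thesis by simp
qed

text \<open>Reduces to \<open>mark_weight_bound\<close>: before the first find all placements
  produce the same path, and after a first find at \<open>q\<close> they share one continuation
  until the second find.\<close>

lemma strategy_weight_bound:
  assumes S: "S \<in> strategies 2 4 h" and h: "0 < h" "h < 9 / 4"
  shows "(\<Sum>m\<in>marks. \<Sum>m'\<in>marks. if wins 2 2 h S (mark_placement m m') then mark_weight m m' else 0) \<le> 44"
proof -
  define Om where "Om = {p \<in> marks \<times> marks. mark_weight (fst p) (snd p) > 0}"
  define pl where "pl p = mark_placement (fst p) (snd p)" for p
  have pl: "pl p \<in> placements 2 4" if "p \<in> Om" for p
    using that by (auto simp: Om_def pl_def intro: mark_placement_in_placements)
  have dig: "digging 4 h (S (pl p))" if "p \<in> Om" for p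
    using S pl[OF that] by (auto simp: strategies_def)
  define c where "c p q = crossing h (S (pl p)) (fst q) (real (snd q) / 4)" for p q
  define c1 where "c1 p = min (c p (fst p)) (c p (snd p))" for p
  define c2 where "c2 p = max (c p (fst p)) (c p (snd p))" for p
  have c_iff: "real (snd q) / 4 \<le> S (pl p) t (fst q) \<longleftrightarrow> c p q \<le> t"
    if "p \<in> Om" "fst q < 4" "0 \<le> t" "t \<le> h" for p q t
    unfolding c_def using that by (intro crossing_iff[OF dig]) auto
  have c_range: "c p q \<in> {0..h} \<union> {h + 1}" for p q
    unfolding c_def using h by (intro crossing_range) auto
  have Om_marks: "fst p \<in> marks" "snd p \<in> marks" "fst (fst p) < 4" "fst (snd p) < 4" if "p \<in> Om" for p
    using that by (auto simp: Om_def marks_def)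
  have found: "found 2 (pl p) (S (pl p) t) = (if c p (fst p) \<le> t then {#location (fst p)#} else {#})
      + (if c p (snd p) \<le> t then {#location (snd p)#} else {#})" if "p \<in> Om" "0 \<le> t" "t \<le> h" for p t
    using c_iff[OF that(1) _ that(2,3)] Om_marks[OF that(1)] by (simp add: found_two pl_def)
  have wins: "wins 2 2 h S (pl p) \<longleftrightarrow> c2 p \<le> h" if "p \<in> Om" for p
    using c_iff[OF that, of _ h] Om_marks[OF that] h by (simp add: wins_two pl_def c2_def)
  have Om_fin: "finite Om" by (simp add: Om_def)
  have Om_ne: "((0, 1), (0, 4)) \<in> Om"
    by (simp add: Om_def marks_def mark_weight_def weight_same_def)
  \<comment> \<open>The placement whose first find comes last. Until its own first find, every other
    placement produces the same process as \<open>p0\<close>, so \<open>T\<close> records the common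
    path.\<close>
  obtain p0 where p0: "p0 \<in> Om" "\<And>p. p \<in> Om \<Longrightarrow> c1 p \<le> c1 p0"
    using ex_max_on[of Om c1] Om_fin Om_ne by (metis empty_iff)
  define T where "T = c p0"
  have agree0: "S (pl p) t i = S (pl p0) t i" if "p \<in> Om" "0 \<le> t" "t \<le> c1 p" "c1 p \<le> h" "i < 4" for p t i
  proof (rule strategy_agree[OF S pl[OF that(1)] pl[OF p0(1)] that(4) _ that(2,3,5)])
    fix s assume "0 \<le> s" "s < c1 p"
    then show "found 2 (pl p) (S (pl p) s) = found 2 (pl p0) (S (pl p0) s)"
      using p0(2)[OF that(1)] that by (subst (1 2) found) (auto simp: c1_def p0)
  qed
  have T_c: "T q \<le> t \<longleftrightarrow> c p q \<le> t" if "p \<in> Om" "0 \<le> t" "t \<le> c1 p" "c1 p \<le> h" "fst q < 4" for p q t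
    using c_iff[OF that(1,5,2)] c_iff[OF p0(1) that(5,2)] agree0[OF that] that(3,4) by (simp add: T_def)
  have T_range: "T q \<in> {0..h} \<union> {h + 1}" for q
    using c_range by (simp add: T_def)
  have c1_nonneg: "0 \<le> c1 p" for p
    using c_range[of p "fst p"] c_range[of p "snd p"] h by (auto simp: c1_def)
  have c1_T: "c1 p = min (T (fst p)) (T (snd p))" if p: "p \<in> Om" and "c1 p \<le> h" for p
  proof -
    note Tc = T_c[OF p _ _ that(2)]
    have 1: "c1 p \<le> T q" if "q = fst p \<or> q = snd p" for q
    proof (rule ccontr)
      assume "\<not> c1 p \<le> T q"
      then have "T q < c1 p" by simp
      moreover have "0 \<le> T q" using T_range[of q] h by auto
      ultimately have "c p q \<le> T q"
        using Tc[of "T q" q] Om_marks[OF p] that by auto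
      then show False using \<open>T q < c1 p\<close> that by (auto simp: c1_def)
    qed
    have "T (fst p) \<le> c1 p \<or> T (snd p) \<le> c1 p"
      using Tc[OF c1_nonneg order.refl, of "fst p"] Tc[OF c1_nonneg order.refl, of "snd p"] Om_marks[OF p]
      by (auto simp: c1_def)
    then show ?thesis using 1[of "fst p"] 1[of "snd p"] by auto
  qed
  show ?thesis
  proof (rule mark_weight_bound[where T = T and h = h])
    fix m m' assume m: "m \<in> marks" "m' \<in> marks" "mark_weight m m' > 0"
    then have Om: "(m, m') \<in> Om" "(m', m) \<in> Om"
      using mark_weight_commute[of m m'] by (auto simp: Om_def)
    \<comment> \<open>The searcher does not see labels, so swapping the two nuts changes
      nothing.\<close>
    have "found 2 (pl (m, m')) d = found 2 (pl (m', m)) d" for d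
      by (simp add: found_two pl_def add.commute)
    then have "S (pl (m, m')) h i = S (pl (m', m)) h i" if "i < 4" for i
      using h that by (intro strategy_nonanticipative[OF S pl[OF Om(1)] pl[OF Om(2)]]) auto
    then show "wins 2 2 h S (mark_placement m m') \<longleftrightarrow> wins 2 2 h S (mark_placement m' m)"
      using m by (auto simp: wins_two pl_def marks_def)
  next
    fix m m' assume m: "m \<in> marks" "m' \<in> marks" "mark_weight m m' > 0" "wins 2 2 h S (mark_placement m m')"
    then have "(m, m') \<in> Om" by (auto simp: Om_def)
    moreover from this have "c2 (m, m') \<le> h" using wins[of "(m, m')"] m by (simp add: pl_def)
    moreover from this have "c1 (m, m') \<le> h" by (auto simp: c1_def c2_def)
    ultimately have "min (T m) (T m') \<le> h" using c1_T[of "(m, m')"] by simp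
    then show "T m \<le> h \<or> T m' \<le> h" by (simp add: min_le_iff_disj)
  next
    fix i a b :: nat assume i: "i < 4" and "a \<le> b"
    show "T (i, a) \<le> T (i, b)"
    proof (cases "T (i, b) \<le> h")
      case True
      then have 0: "0 \<le> T (i, b)" using T_range[of "(i, b)"] h by auto
      have "real b / 4 \<le> S (pl p0) (T (i, b)) i"
        using c_iff[OF p0(1) _ 0 True, of "(i, b)"] i by (simp add: T_def)
      then have "real a / 4 \<le> S (pl p0) (T (i, b)) i" using \<open>a \<le> b\<close> by simp
      then show ?thesis
        using c_iff[OF p0(1) _ 0 True, of "(i, a)"] i by (simp add: T_def)
    next
      case False
      then have "T (i, b) = h + 1" using T_range[of "(i, b)"] by auto
      then show ?thesis using T_range[of "(i, a)"] by auto
    qed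
  next
    fix q assume q: "q \<in> marks" "T q \<le> h"
    have q4: "fst q < 4" using q by (auto simp: marks_def)
    have Tq: "0 \<le> T q" using T_range[of q] h by auto
    \<comment> \<open>The partners with which \<open>S\<close> wins after finding \<open>q\<close>
      first.\<close>
    define R where "R = {r \<in> marks. mark_weight q r > 0 \<and> wins 2 2 h S (mark_placement q r) \<and> T q \<le> T r}"
    have R_Om: "(q, r) \<in> Om" if "r \<in> R" for r
      using that q by (auto simp: R_def Om_def)
    have R: "c1 (q, r) = T q" "c (q, r) q = T q" "c2 (q, r) = c (q, r) r" "c (q, r) r \<le> h" if "r \<in> R" for r
    proof -
      have "c2 (q, r) \<le> h"
        using wins[OF R_Om[OF that]] that by (simp add: R_def pl_def)
      moreover from this have "c1 (q, r) \<le> h" by (auto simp: c1_def c2_def)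
      ultimately show 1: "c1 (q, r) = T q"
        using c1_T[OF R_Om[OF that]] that by (auto simp: R_def)
      then have "c (q, r) q \<le> T q"
        using T_c[OF R_Om[OF that] Tq _ _ q4] q by simp
      with 1 show 2: "c (q, r) q = T q" by (auto simp: c1_def)
      with 1 show 3: "c2 (q, r) = c (q, r) r" by (auto simp: c1_def c2_def)
      show "c (q, r) r \<le> h" using \<open>c2 (q, r) \<le> h\<close> 3 by simp
    qed
    obtain D t where D: "digging 4 h D" "0 \<le> t" "t \<le> h"
      "\<And>r. \<lbrakk>r \<in> marks; T r \<le> T q\<rbrakk> \<Longrightarrow> real (snd r) / 4 \<le> D t (fst r)"
      "\<And>r. r \<in> R \<Longrightarrow> real (snd r) / 4 \<le> D t (fst r)"
    proof (cases "R = {}")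
      case True
      show ?thesis
      proof (rule that[OF dig[OF p0(1)] Tq q(2)])
        fix r assume "r \<in> marks" "T r \<le> T q"
        then show "real (snd r) / 4 \<le> S (pl p0) (T q) (fst r)"
          using c_iff[OF p0(1) _ Tq q(2)] by (auto simp: T_def marks_def)
      qed (use True in simp)
    next
      case False
      have "finite R" by (simp add: R_def)
      \<comment> \<open>The partner that is found last. Until \<open>r\<close> is found, the process
        against \<open>(q, r)\<close> agrees with that against \<open>(q, r0)\<close>, so the latter
        covers all of \<open>R\<close>.\<close>
      obtain r0 where r0: "r0 \<in> R" "\<And>r. r \<in> R \<Longrightarrow> c2 (q, r) \<le> c2 (q, r0)"
        using ex_max_on[of R "\<lambda>r. c2 (q, r)"] \<open>finite R\<close> False by metis
      note O0 = R_Om[OF r0(1)]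
      show ?thesis
      proof (rule that[OF dig[OF O0] _ order.refl])
        fix r assume r: "r \<in> marks" "T r \<le> T q"
        then have "c (q, r0) r \<le> T q"
          using T_c[OF O0 Tq, of r] R(1)[OF r0(1)] q by (auto simp: marks_def)
        then have "c (q, r0) r \<le> h" using q by simp
        then show "real (snd r) / 4 \<le> S (pl (q, r0)) h (fst r)"
          using c_iff[OF O0, of r h] r h by (auto simp: marks_def)
      next
        fix r assume r: "r \<in> R"
        note Or = R_Om[OF r]
        have le: "c (q, r) r \<le> c (q, r0) r0"
          using r0(2)[OF r] R(3)[OF r] R(3)[OF r0(1)] by simp
        have r4: "fst r < 4" using r by (auto simp: R_def marks_def)
        have c0: "0 \<le> c (q, r) r" using c_range[of "(q, r)" r] h by auto
        have "S (pl (q, r)) (c (q, r) r) (fst r) = S (pl (q, r0)) (c (q, r) r) (fst r)"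
        proof (rule strategy_agree[OF S pl[OF Or] pl[OF O0] R(4)[OF r] _ c0 order.refl r4])
          fix s assume s: "0 \<le> s" "s < c (q, r) r"
          then have "s \<le> h" using R(4)[OF r] by simp
          then show "found 2 (pl (q, r)) (S (pl (q, r)) s) = found 2 (pl (q, r0)) (S (pl (q, r0)) s)"
            using s le R(2)[OF r] R(2)[OF r0(1)] by (simp add: found Or O0)
        qed
        moreover have "real (snd r) / 4 \<le> S (pl (q, r)) (c (q, r) r) (fst r)"
          using c_iff[OF Or r4 c0 R(4)[OF r]] by simp
        moreover have "S (pl (q, r0)) (c (q, r) r) (fst r) \<le> S (pl (q, r0)) h (fst r)"
          using R(4)[OF r] r4 c0 by (intro digging_mono[OF dig[OF O0]]) auto
        ultimately show "real (snd r) / 4 \<le> S (pl (q, r0)) h (fst r)" by simp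
      qed (use h in auto)
    qed
    obtain e where e: "\<forall>l<4. e l \<le> (4::nat)" "(\<Sum>l<4. e l) \<le> 8"
      "\<And>l b. \<lbrakk>l < 4; b \<le> 4; real b / 4 \<le> D t l\<rbrakk> \<Longrightarrow> b \<le> e l"
      using ex_grid_depth[OF D(1-3) h(2)] by blast
    have "snd r \<le> e (fst r)" if "r \<in> marks" "T r \<le> T q \<or> r \<in> R" for r
      using that D(4,5)[of r] by (intro e(3)) (auto simp: marks_def)
    then show "\<exists>e. (\<forall>l<4. e l \<le> 4) \<and> (\<Sum>l<4. e l) \<le> 8 \<and> (\<forall>r\<in>marks. T r \<le> T q \<longrightarrow> snd r \<le> e (fst r)) \<and>
        (\<forall>r\<in>marks. mark_weight q r > 0 \<longrightarrow> wins 2 2 h S (mark_placement q r) \<longrightarrow> T q \<le> T r \<longrightarrow> snd r \<le> e (fst r))"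
      using e by (intro exI[of _ e]) (auto simp: R_def)
  qed
qed

section \<open>Values and finite mixtures\<close>

lemma space_placement_space [simp]: "space (placement_space k n) = placements k n"
  by (auto simp: placement_space_def space_restrict_space space_PiM placements_def PiE_def)

lemma singleton_in_placement_space:
  assumes P: "P \<in> placements k n"
  shows "{P} \<in> sets (placement_space k n)"
proof -
  have "{Q \<in> space (PiM {..<k} (\<lambda>_. borel)). \<forall>j\<in>{..<k}. Q j = P j} \<in> sets (PiM {..<k} (\<lambda>_. borel :: (nat \<times> real) measure))"
    by measurable
  moreover have "{Q \<in> space (PiM {..<k} (\<lambda>_. borel)). \<forall>j\<in>{..<k}. Q j = P j} = {P}"
    using P by (auto simp: space_PiM placements_def PiE_def intro: extensionalityI)
  ultimately show ?thesis
    using P unfolding placement_space_def sets_restrict_space by (intro image_eqI[of _ _ "{P}"]) auto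
qed

lemma measurable_uniform_count:
  "g ` I \<subseteq> space M \<Longrightarrow> g \<in> measurable (uniform_count_measure I) M"
  by (auto simp: measurable_def space_uniform_count_measure sets_uniform_count_measure)

text \<open>Since \<open>g\<close> may repeat values, a uniform index set can encode any rational
  weights.\<close>

lemma mixed_hidings_distr:
  assumes I: "finite I" "I \<noteq> {}" and g: "g ` I \<subseteq> X" and X: "X \<subseteq> placements k n"
  shows "distr (uniform_count_measure I) (placement_space k n) g \<in> mixed_hidings k n X"
proof -
  interpret I: prob_space "uniform_count_measure I"
    using I by (intro prob_space_uniform_count_measure)
  have m: "g \<in> measurable (uniform_count_measure I) (placement_space k n)"
    using g X by (intro measurable_uniform_count) auto
  have "(\<Union>i\<in>I. {g i}) \<in> sets (placement_space k n)"
    using I g X by (intro sets.finite_UN singleton_in_placement_space) auto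
  moreover have "{P \<in> space (placement_space k n). P \<in> g ` I} = (\<Union>i\<in>I. {g i})"
    using g X by auto
  ultimately have "{P \<in> space (placement_space k n). P \<in> g ` I} \<in> sets (placement_space k n)"
    by simp
  then have "AE P in distr (uniform_count_measure I) (placement_space k n) g. P \<in> g ` I"
    using m by (subst AE_distr_iff) (auto simp: space_uniform_count_measure intro!: AE_I2)
  then have "AE P in distr (uniform_count_measure I) (placement_space k n) g. P \<in> X"
    by eventually_elim (use g in auto)
  then show ?thesis
    using I.prob_space_distr[OF m] by (simp add: mixed_hidings_def)
qed

lemma measure_distr_uniform_count:
  assumes "finite I" "g \<in> measurable (uniform_count_measure I) M" "{x \<in> space M. Q x} \<in> sets M"
  shows "measure (distr (uniform_count_measure I) M g) {x \<in> space M. Q x} = real (card {i \<in> I. Q (g i)}) / real (card I)"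
proof -
  have "g i \<in> space M" if "i \<in> I" for i
    using measurable_space[OF assms(2)] that by (simp add: space_uniform_count_measure)
  then have "g -` {x \<in> space M. Q x} \<inter> space (uniform_count_measure I) = {i \<in> I. Q (g i)}"
    by (auto simp: space_uniform_count_measure)
  then show ?thesis
    using assms by (simp add: measure_distr measure_uniform_count_measure)
qed

lemma mixed_searches_distr:
  assumes I: "finite I" "I \<noteq> {}" and f: "f ` I \<subseteq> pure_searches k j n h"
  shows "distr (uniform_count_measure I) (count_space (f ` I)) f \<in> mixed_searches k j n h"
proof -
  interpret I: prob_space "uniform_count_measure I"
    using I by (intro prob_space_uniform_count_measure)
  let ?N = "distr (uniform_count_measure I) (count_space (f ` I)) f"
  have m: "f \<in> measurable (uniform_count_measure I) (count_space (f ` I))"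
    by (intro measurable_uniform_count) auto
  have "{(S, P). S \<in> space ?N \<and> P \<in> placements k n \<and> wins k j h S P}
      = (\<Union>S\<in>f ` I. {S} \<times> {P \<in> placements k n. wins k j h S P})"
    by auto
  also have "\<dots> \<in> sets (?N \<Otimes>\<^sub>M placement_space k n)"
    using I f by (intro sets.finite_UN pair_measureI) (auto simp: pure_searches_def)
  finally show ?thesis
    using I.prob_space_distr[OF m] f by (auto simp: mixed_searches_def pure_searches_def)
qed

text \<open>The exchange of averaging over finitely many pure choices of one player with integration
  over the mixed strategy of the other.\<close>

lemma sum_measure_eq_integral:
  assumes "prob_space M" "finite I" "\<And>i. i \<in> I \<Longrightarrow> {x \<in> space M. W i x} \<in> sets M"
  shows "integrable M (\<lambda>x. real (card {i \<in> I. W i x}))" (is ?int)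
    and "(\<Sum>i\<in>I. measure M {x \<in> space M. W i x}) = (\<integral>x. real (card {i \<in> I. W i x}) \<partial>M)" (is ?eq)
proof -
  interpret prob_space M by fact
  have eq: "real (card {i \<in> I. W i x}) = (\<Sum>i\<in>I. indicator {x \<in> space M. W i x} x)" if "x \<in> space M" for x
    using that \<open>finite I\<close> by (simp add: indicator_def sum.If_cases Collect_conj_eq)
  have int: "integrable M (indicator {x \<in> space M. W i x} :: _ \<Rightarrow> real)" if "i \<in> I" for i
    using assms(3)[OF that] by (simp add: integrable_indicator_iff less_top[symmetric])
  show ?int
    using int by (subst Bochner_Integration.integrable_cong[OF refl eq]) auto
  have "(\<integral>x. real (card {i \<in> I. W i x}) \<partial>M) = (\<integral>x. (\<Sum>i\<in>I. indicator {x \<in> space M. W i x} x) \<partial>M)"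
    by (intro Bochner_Integration.integral_cong[OF refl eq])
  also have "\<dots> = (\<Sum>i\<in>I. measure M {x \<in> space M. W i x})"
    using int assms(3) by (subst Bochner_Integration.integral_sum) auto
  finally show ?eq by simp
qed

text \<open>The uniform mixture of the placements \<open>g i\<close> is the hiding strategy;
  \<open>a\<close> bounds the fraction of them that one searching strategy beats. The search sets
  must be nonempty for the suprema to be meaningful.\<close>

lemma value_le:
  fixes g :: "'i \<Rightarrow> placement"
  assumes I: "finite I" "I \<noteq> {}" and g: "g ` I \<subseteq> placements k n"
    and ne: "mixed_searches k j n h \<noteq> {}" "pure_searches k j n h \<noteq> {}"
    and a: "\<And>S. S \<in> strategies k n h \<Longrightarrow> real (card {i \<in> I. wins k j h S (g i)}) \<le> a * real (card I)"
  shows "value_sup_inf k j n h (placements k n) \<le> a" "value_inf_sup k j n h (placements k n) \<le> a"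
proof -
  have cI: "0 < real (card I)" using I by (simp add: card_gt_0_iff)
  show "value_sup_inf k j n h (placements k n) \<le> a"
    unfolding value_sup_inf_def
  proof (rule cSUP_least[OF ne(1)])
    fix \<nu> assume \<nu>: "\<nu> \<in> mixed_searches k j n h"
    interpret prob_space \<nu> using \<nu> by (simp add: mixed_searches_def)
    have m: "{S \<in> space \<nu>. wins k j h S P} \<in> sets \<nu>" if P: "P \<in> placements k n" for P
    proof -
      have "(\<lambda>S. (S, P)) -` {(S, P). S \<in> space \<nu> \<and> P \<in> placements k n \<and> wins k j h S P} \<in> sets \<nu>"
        using \<nu> by (intro sets_Pair2[where ?M2.0 = "placement_space k n"]) (auto simp: mixed_searches_def)
      also have "(\<lambda>S. (S, P)) -` {(S, P). S \<in> space \<nu> \<and> P \<in> placements k n \<and> wins k j h S P} = {S \<in> space \<nu>. wins k j h S P}"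
        using P by auto
      finally show ?thesis .
    qed
    let ?m = "\<lambda>P. measure \<nu> {S \<in> space \<nu>. wins k j h S P}"
    have "real (card I) * (INF P\<in>placements k n. ?m P) = (\<Sum>i\<in>I. INF P\<in>placements k n. ?m P)"
      by simp
    also have "\<dots> \<le> (\<Sum>i\<in>I. ?m (g i))"
      using g by (intro sum_mono cINF_lower bdd_belowI[of _ 0]) auto
    also have "\<dots> = (\<integral>S. real (card {i \<in> I. wins k j h S (g i)}) \<partial>\<nu>)"
      using I g m by (intro sum_measure_eq_integral) (auto intro: prob_space_axioms)
    also have "\<dots> \<le> a * real (card I)"
    proof (rule integral_le_const)
      show "integrable \<nu> (\<lambda>S. real (card {i \<in> I. wins k j h S (g i)}))"
        using I g m by (intro sum_measure_eq_integral) (auto intro: prob_space_axioms)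
      show "AE S in \<nu>. real (card {i \<in> I. wins k j h S (g i)}) \<le> a * real (card I)"
        using \<nu> a by (intro AE_I2) (auto simp: mixed_searches_def)
    qed
    finally show "(INF P\<in>placements k n. ?m P) \<le> a"
      using cI by (simp add: mult.commute)
  qed
  let ?\<mu> = "distr (uniform_count_measure I) (placement_space k n) g"
  have "value_inf_sup k j n h (placements k n) \<le> hiding_guarantee k j n h ?\<mu>"
    unfolding value_inf_sup_def
  proof (rule cINF_lower)
    show "?\<mu> \<in> mixed_hidings k n (placements k n)"
      using I g by (intro mixed_hidings_distr) auto
    obtain S where S: "S \<in> pure_searches k j n h" using ne by blast
    show "bdd_below (hiding_guarantee k j n h ` mixed_hidings k n (placements k n))"
    proof (rule bdd_belowI2[of _ 0])
      fix \<mu> assume "\<mu> \<in> mixed_hidings k n (placements k n)"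
      then interpret prob_space \<mu> by (simp add: mixed_hidings_def)
      show "0 \<le> hiding_guarantee k j n h \<mu>"
        unfolding hiding_guarantee_def using S
        by (intro cSUP_upper2[OF _ S]) (auto intro!: bdd_aboveI[of _ 1])
    qed
  qed
  also have "\<dots> \<le> a"
    unfolding hiding_guarantee_def
  proof (rule cSUP_least[OF ne(2)])
    fix S assume S: "S \<in> pure_searches k j n h"
    have "measure ?\<mu> {P \<in> space (placement_space k n). wins k j h S P} = real (card {i \<in> I. wins k j h S (g i)}) / real (card I)"
      using I g S by (intro measure_distr_uniform_count measurable_uniform_count) (auto simp: pure_searches_def)
    also have "\<dots> \<le> a"
      using a[of S] S cI by (simp add: pure_searches_def divide_le_eq)
    finally show "measure ?\<mu> {P \<in> placements k n. wins k j h S P} \<le> a" by simp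
  qed
  finally show "value_inf_sup k j n h (placements k n) \<le> a" .
qed

text \<open>Dual to \<open>value_le\<close>: the searcher mixes the strategies \<open>f i\<close>
  uniformly.\<close>

lemma value_ge:
  fixes f :: "'i \<Rightarrow> strategy"
  assumes I: "finite I" "I \<noteq> {}" and f: "f ` I \<subseteq> pure_searches k j n h"
    and X: "X \<noteq> {}" "X \<subseteq> placements k n"
    and b: "\<And>P. P \<in> X \<Longrightarrow> b * real (card I) \<le> real (card {i \<in> I. wins k j h (f i) P})"
  shows "b \<le> value_sup_inf k j n h X"
    "\<And>\<mu>. \<mu> \<in> mixed_hidings k n X \<Longrightarrow> b \<le> hiding_guarantee k j n h \<mu>"
    "b \<le> value_inf_sup k j n h X"
proof -
  have cI: "0 < real (card I)" using I by (simp add: card_gt_0_iff)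
  let ?\<nu> = "distr (uniform_count_measure I) (count_space (f ` I)) f"
  have "b \<le> (INF P\<in>X. measure ?\<nu> {S \<in> space ?\<nu>. wins k j h S P})"
  proof (rule cINF_greatest[OF X(1)])
    fix P assume P: "P \<in> X"
    have "measure ?\<nu> {S \<in> space (count_space (f ` I)). wins k j h S P} = real (card {i \<in> I. wins k j h (f i) P}) / real (card I)"
      using I by (intro measure_distr_uniform_count measurable_uniform_count) auto
    then show "b \<le> measure ?\<nu> {S \<in> space ?\<nu>. wins k j h S P}"
      using b[OF P] cI by (simp add: le_divide_eq)
  qed
  also have "\<dots> \<le> value_sup_inf k j n h X"
    unfolding value_sup_inf_def
  proof (rule cSUP_upper[OF mixed_searches_distr[OF I f]])
    obtain P where P: "P \<in> X" using X by blast
    show "bdd_above ((\<lambda>\<nu>. INF P\<in>X. measure \<nu> {S \<in> space \<nu>. wins k j h S P}) ` mixed_searches k j n h)"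
    proof (rule bdd_aboveI2[of _ _ 1])
      fix \<nu> assume "\<nu> \<in> mixed_searches k j n h"
      then interpret prob_space \<nu> by (simp add: mixed_searches_def)
      show "(INF P\<in>X. measure \<nu> {S \<in> space \<nu>. wins k j h S P}) \<le> 1"
        using P by (intro cINF_lower2[OF _ P]) (auto intro!: bdd_belowI[of _ 0])
    qed
  qed
  finally show "b \<le> value_sup_inf k j n h X" .
  show guarantee: "b \<le> hiding_guarantee k j n h \<mu>" if \<mu>: "\<mu> \<in> mixed_hidings k n X" for \<mu>
  proof -
    interpret prob_space \<mu> using \<mu> by (simp add: mixed_hidings_def)
    have sets: "sets \<mu> = sets (placement_space k n)" using \<mu> by (simp add: mixed_hidings_def)
    have space: "space \<mu> = placements k n"
      using sets_eq_imp_space_eq[OF sets] by simp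
    have m: "{P \<in> space \<mu>. wins k j h (f i) P} \<in> sets \<mu>" if "i \<in> I" for i
      using f that by (auto simp: sets space pure_searches_def)
    have "b * real (card I) \<le> (\<integral>P. real (card {i \<in> I. wins k j h (f i) P}) \<partial>\<mu>)"
    proof (rule integral_ge_const)
      show "integrable \<mu> (\<lambda>P. real (card {i \<in> I. wins k j h (f i) P}))"
        using I m by (intro sum_measure_eq_integral) (auto intro: prob_space_axioms)
      have "AE P in \<mu>. P \<in> X" using \<mu> by (simp add: mixed_hidings_def)
      then show "AE P in \<mu>. b * real (card I) \<le> real (card {i \<in> I. wins k j h (f i) P})"
        by eventually_elim (rule b)
    qed
    also have "\<dots> = (\<Sum>i\<in>I. measure \<mu> {P \<in> space \<mu>. wins k j h (f i) P})"
      using I m by (intro sum_measure_eq_integral(2)[symmetric]) (auto intro: prob_space_axioms)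
    also have "\<dots> \<le> (\<Sum>i\<in>I. hiding_guarantee k j n h \<mu>)"
      unfolding hiding_guarantee_def space using f
      by (intro sum_mono cSUP_upper) (auto intro!: bdd_aboveI[of _ 1])
    finally show ?thesis using cI by (simp add: mult.commute)
  qed
  obtain P where P: "P \<in> X" using X by blast
  \<comment> \<open>A point mass shows that the infimum is over a nonempty set.\<close>
  have "mixed_hidings k n X \<noteq> {}"
    using mixed_hidings_distr[of "{()}" "\<lambda>_. P" X k n] X(2) P by auto
  then show "b \<le> value_inf_sup k j n h X"
    unfolding value_inf_sup_def by (intro cINF_greatest guarantee)
qed

section \<open>Exploring until the first find\<close>

definition nut_locations :: "nat \<Rightarrow> (nat \<times> real) set" where
  "nut_locations n = {..<n} \<times> {0<..1}"

text \<open>Ties go to nut 0. They are harmless, since arrival times up to \<open>h\<close> are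
  assumed below to determine the location.\<close>

definition first_nut :: "(nat \<times> real \<Rightarrow> real) \<Rightarrow> placement \<Rightarrow> nat \<times> real" where
  "first_nut T P = (if T (P 0) \<le> T (P 1) then P 0 else P 1)"

text \<open>
  Follow the process \<open>E\<close>, which reaches the location \<open>p\<close> at time \<open>T p\<close>, until the first nut is found.
  If its location is \<open>p\<close>, then dig at constant speeds so that the depths at time \<open>h\<close> are \<open>e p\<close>.
\<close>

definition explore_react ::
    "(real \<Rightarrow> nat \<Rightarrow> real) \<Rightarrow> (nat \<times> real \<Rightarrow> real) \<Rightarrow> (nat \<times> real \<Rightarrow> nat \<Rightarrow> real) \<Rightarrow> real \<Rightarrow> strategy" where
  "explore_react E T e h P t l =
     (let p = first_nut T P
      in E (min t (T p)) l + max 0 (t - T p) / (h - T p) * (e p l - E (T p) l))"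

lemma explore_react_before: "t \<le> T (first_nut T P) \<Longrightarrow> explore_react E T e h P t l = E t l"
  by (simp add: explore_react_def Let_def)

lemma explore_react_end:
  "T (first_nut T P) < h \<Longrightarrow> explore_react E T e h P h l = e (first_nut T P) l"
  by (simp add: explore_react_def Let_def)

lemma placements_two_locations:
  assumes "P \<in> placements 2 n"
  shows "P 0 \<in> nut_locations n" "P 1 \<in> nut_locations n" "first_nut T P \<in> nut_locations n"
  using assms
  by (auto simp: placements_two_iff nut_locations_def first_nut_def mem_Times_iff total_depth_two split: if_splits)

context
  fixes E :: "real \<Rightarrow> nat \<Rightarrow> real" and T :: "nat \<times> real \<Rightarrow> real" and e :: "nat \<times> real \<Rightarrow> nat \<Rightarrow> real"
    and n :: nat and h :: real
  assumes E: "digging n h E"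
    and reach: "\<And>p t. \<lbrakk>p \<in> nut_locations n; 0 \<le> t; t \<le> h\<rbrakk> \<Longrightarrow> snd p \<le> E t (fst p) \<longleftrightarrow> T p \<le> t"
    and T_nonneg: "\<And>p. p \<in> nut_locations n \<Longrightarrow> 0 \<le> T p"
    and T_less: "\<And>p. \<lbrakk>p \<in> nut_locations n; T p \<le> h\<rbrakk> \<Longrightarrow> T p < h"
    and T_inj: "\<And>p q. \<lbrakk>p \<in> nut_locations n; q \<in> nut_locations n; T p = T q; T p \<le> h\<rbrakk> \<Longrightarrow> p = q"
    and e_ge: "\<And>p l. \<lbrakk>p \<in> nut_locations n; T p \<le> h; l < n\<rbrakk> \<Longrightarrow> E (T p) l \<le> e p l"
    and e_sum: "\<And>p. \<lbrakk>p \<in> nut_locations n; T p \<le> h\<rbrakk> \<Longrightarrow> (\<Sum>l<n. e p l - E (T p) l) \<le> h - T p"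
begin

text \<open>After the find, \<open>?u\<close> rises linearly from 0 to 1 and interpolates between
  the explored and the final depths: \<open>e_ge\<close> gives monotonicity, \<open>e_sum\<close>
  the speed bound and \<open>T_less\<close> a nonzero denominator.\<close>

lemma explore_react_digging:
  assumes P: "P \<in> placements 2 n"
  shows "digging n h (explore_react E T e h P)"
proof -
  define p where "p = first_nut T P"
  have p: "p \<in> nut_locations n" using placements_two_locations[OF P] by (simp add: p_def)
  let ?D = "explore_react E T e h P"
  let ?u = "\<lambda>t. max 0 (t - T p) / (h - T p)"
  have D: "?D t l = E (min t (T p)) l + ?u t * (e p l - E (T p) l)" for t l
    by (simp add: explore_react_def p_def Let_def)
  have T0: "0 \<le> T p" by (rule T_nonneg[OF p])
  have "?D 0 l = 0" if "l < n" for l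
    using E T0 that by (simp add: D digging_def)
  moreover have "(\<forall>l<n. ?D s l \<le> ?D t l) \<and> (\<Sum>l<n. ?D t l - ?D s l) \<le> t - s"
    if st: "0 \<le> s" "s \<le> t" "t \<le> h" for s t
  proof (cases "T p \<le> h")
    case False
    then have "?D r l = E r l" if "r \<le> h" for r l
      using that by (simp add: D)
    then show ?thesis using digging_mono[OF E st] digging_sum_diff_le[OF E st] st by simp
  next
    case True
    note Tp = T_less[OF p True]
    have u: "0 \<le> ?u t - ?u s"
      using st Tp by (simp add: diff_divide_distrib[symmetric])
    have E1: "E (min s (T p)) l \<le> E (min t (T p)) l" if "l < n" for l
      using st T0 that by (intro digging_mono[OF E]) auto
    have E2: "(\<Sum>l<n. E (min t (T p)) l - E (min s (T p)) l) \<le> min t (T p) - min s (T p)"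
      using st T0 by (intro digging_sum_diff_le[OF E]) auto
    have diff: "?D t l - ?D s l = (E (min t (T p)) l - E (min s (T p)) l) + (?u t - ?u s) * (e p l - E (T p) l)" for l
      by (simp add: D algebra_simps)
    have "?D s l \<le> ?D t l" if "l < n" for l
      using E1[OF that] mult_nonneg_nonneg[OF u, of "e p l - E (T p) l"] e_ge[OF p True that] diff[of l] by linarith
    moreover have "(\<Sum>l<n. ?D t l - ?D s l) \<le> t - s"
    proof -
      have "(\<Sum>l<n. ?D t l - ?D s l) = (\<Sum>l<n. E (min t (T p)) l - E (min s (T p)) l) + (?u t - ?u s) * (\<Sum>l<n. e p l - E (T p) l)"
        unfolding diff by (simp only: sum.distrib sum_distrib_left)
      also have "\<dots> \<le> (min t (T p) - min s (T p)) + (?u t - ?u s) * (h - T p)"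
        using E2 u e_sum[OF p True] by (intro add_mono mult_left_mono)
      also have "(?u t - ?u s) * (h - T p) = max 0 (t - T p) - max 0 (s - T p)"
        using Tp by (simp add: diff_divide_distrib[symmetric])
      finally show ?thesis by auto
    qed
    ultimately show ?thesis by blast
  qed
  ultimately show ?thesis by (auto simp: digging_def)
qed

text \<open>The finds along \<open>E\<close> reveal the location of the first nut and its time, and
  the later digging depends on nothing else.\<close>

lemma explore_react_strategy: "explore_react E T e h \<in> strategies 2 n h"
proof -
  let ?S = "explore_react E T e h"
  have found_E: "found 2 P (E s) = (if T (P 0) \<le> s then {#P 0#} else {#}) + (if T (P 1) \<le> s then {#P 1#} else {#})"
    if "P \<in> placements 2 n" "0 \<le> s" "s \<le> h" for P s
    using reach[OF placements_two_locations(1)[OF that(1)] that(2,3)]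
      reach[OF placements_two_locations(2)[OF that(1)] that(2,3)] by (simp add: found_two)
  have empty: "found 2 P (E s) = {#} \<longleftrightarrow> s < T (first_nut T P)"
    if "P \<in> placements 2 n" "0 \<le> s" "s \<le> h" for P s
    using found_E[OF that] by (auto simp: first_nut_def)
  have na: "?S P t i = ?S Q t i"
    if P: "P \<in> placements 2 n" and Q: "Q \<in> placements 2 n" and t: "0 \<le> t" "t \<le> h" and i: "i < n"
      and eq: "\<And>s. \<lbrakk>0 \<le> s; s < t\<rbrakk> \<Longrightarrow> found 2 P (?S P s) = found 2 Q (?S P s)" for P Q t i
  proof -
    define p where "p = first_nut T P"
    define q where "q = first_nut T Q"
    have p: "p \<in> nut_locations n" "0 \<le> T p" and q: "q \<in> nut_locations n" "0 \<le> T q"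
      using placements_two_locations[OF P] placements_two_locations[OF Q] T_nonneg by (auto simp: p_def q_def)
    have eqE: "found 2 P (E s) = found 2 Q (E s)" if "0 \<le> s" "s < t" "s \<le> T p" for s
    proof -
      have "?S P s = E s"
        using that(3) by (intro ext explore_react_before) (simp add: p_def)
      then show ?thesis using eq[OF that(1,2)] by simp
    qed
    show ?thesis
    proof (cases "t \<le> T p")
      case True
      \<comment> \<open>Otherwise \<open>Q\<close> would show a nut at time \<open>T q\<close> while
        \<open>P\<close> still shows none.\<close>
      have "t \<le> T q"
      proof (rule ccontr)
        assume "\<not> t \<le> T q"
        then have "found 2 Q (E (T q)) = found 2 P (E (T q))"
          using True q by (intro eqE[symmetric]) auto
        then show False
          using empty[OF P q(2)] empty[OF Q q(2)] \<open>\<not> t \<le> T q\<close> True t by (simp add: p_def q_def)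
      qed
      then show ?thesis using True by (simp add: explore_react_before p_def q_def)
    next
      case False
      then have Tp: "T p < t" "T p \<le> h" using t by auto
      \<comment> \<open>What is found in \<open>P\<close> at time \<open>T p\<close> must be a nut
        of \<open>Q\<close> as well, so the first find in \<open>Q\<close> is no later;
        \<open>T_inj\<close> then identifies the two locations.\<close>
      have "p \<in># found 2 P (E (T p))"
        using found_E[OF P p(2) Tp(2)] by (auto simp: p_def first_nut_def)
      then have "p \<in># found 2 Q (E (T p))" using eqE[OF p(2) Tp(1)] by simp
      then have "p = Q 0 \<or> p = Q 1"
        using found_E[OF Q p(2) Tp(2)] by (auto split: if_splits)
      then have "T q \<le> T p" by (auto simp: q_def first_nut_def)
      moreover have "T p \<le> T q"
      proof (rule ccontr)
        assume "\<not> T p \<le> T q"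
        then show False
          using empty[OF P q(2)] empty[OF Q q(2)] eqE[OF q(2)] Tp by (simp add: p_def q_def)
      qed
      ultimately have "T p = T q" by simp
      then have "p = q" using T_inj[OF p(1) q(1)] Tp(2) by blast
      then show ?thesis by (simp add: explore_react_def p_def q_def Let_def)
    qed
  qed
  show ?thesis
    unfolding strategies_def
    by (intro CollectI conjI ballI allI impI explore_react_digging na) auto
qed

lemma wins_explore_react:
  assumes "P \<in> placements 2 n" "T (first_nut T P) \<le> h"
    "snd (P 0) \<le> e (first_nut T P) (fst (P 0))" "snd (P 1) \<le> e (first_nut T P) (fst (P 1))"
  shows "wins 2 2 h (explore_react E T e h) P"
  using assms T_less placements_two_locations[OF assms(1)] by (simp add: wins_two explore_react_end)

end

section \<open>Measurability of winning\<close>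

lemma sets_borel_nat_times_real:
  "sets (count_space UNIV \<Otimes>\<^sub>M borel) = sets (borel :: (nat \<times> real) measure)"
proof -
  have "sets (count_space UNIV \<Otimes>\<^sub>M borel) = sets (borel \<Otimes>\<^sub>M borel :: (nat \<times> real) measure)"
    by (intro sets_pair_measure_cong) (simp_all add: sets_borel_eq_count_space)
  also have "borel \<Otimes>\<^sub>M borel = (borel :: (nat \<times> real) measure)"
    by (rule borel_prod)
  finally show ?thesis .
qed

lemma borel_measurable_nat_times_real:
  fixes f :: "nat \<times> real \<Rightarrow> real"
  assumes "\<And>i. (\<lambda>x. f (i, x)) \<in> borel_measurable borel"
  shows "f \<in> borel_measurable borel"
proof -
  have "f \<in> borel_measurable (count_space UNIV \<Otimes>\<^sub>M borel)"
    using measurable_pair_measure_countable1[of UNIV f borel borel] assms by simp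
  then show ?thesis
    by (simp add: measurable_cong_sets[OF sets_borel_nat_times_real refl])
qed

lemma fst_measurable_borel: "fst \<in> measurable (borel :: (nat \<times> real) measure) (count_space UNIV)"
  using measurable_fst[of "count_space (UNIV :: nat set)" "borel :: real measure"]
  by (simp add: measurable_cong_sets[OF sets_borel_nat_times_real refl])

text \<open>The hole \<open>fst (P j)\<close> varies with \<open>P\<close> but takes countably many
  values, so measurability of the final depth of each fixed hole suffices.\<close>

lemma explore_react_borel:
  assumes [measurable]: "T \<in> borel_measurable borel" "\<And>l. (\<lambda>p. e p l) \<in> borel_measurable borel"
    "\<And>l. (\<lambda>t. E t l) \<in> borel_measurable borel"
  shows "{P \<in> placements 2 n. wins 2 2 h (explore_react E T e h) P} \<in> sets (placement_space 2 n)"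
proof -
  have nut: "(\<lambda>P. P j) \<in> measurable (placement_space 2 n) borel" if "j < 2" for j
    unfolding placement_space_def using that by (intro measurable_restrict_space1 measurable_component_singleton) auto
  then have [measurable]: "(\<lambda>P. P 0) \<in> measurable (placement_space 2 n) borel" "(\<lambda>P. P 1) \<in> measurable (placement_space 2 n) borel"
    by simp_all
  have [measurable]: "first_nut T \<in> measurable (placement_space 2 n) borel"
    unfolding first_nut_def by measurable
  have S: "(\<lambda>P. explore_react E T e h P h l) \<in> borel_measurable (placement_space 2 n)" for l
    unfolding explore_react_def Let_def by measurable
  have snd: "(snd :: nat \<times> real \<Rightarrow> real) \<in> borel_measurable borel"
    by (intro borel_measurable_nat_times_real) simp
  have "{P \<in> space (placement_space 2 n). snd (P j) \<le> explore_react E T e h P h (fst (P j))} \<in> sets (placement_space 2 n)"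
    if "j < 2" for j
    using that by (intro borel_measurable_le measurable_compose[OF nut snd]
      measurable_compose_countable[OF S measurable_compose[OF nut fst_measurable_borel]])
  from sets.sets_Collect_conj[OF this[of 1] this[of 0]] show ?thesis
    by (simp add: wins_two)
qed

section \<open>The searching strategy against extremal placements\<close>

text \<open>
  Hole 0 is dug to \<open>7/10\<close>, then hole 1 to \<open>6/10\<close>, hole 0 to \<open>8/10\<close>, hole 1 to \<open>1\<close> and hole 0 to \<open>1\<close>.
  In \<open>arrival\<close>, the value \<open>3\<close> is for the holes 2 and 3, which are not explored.
\<close>

definition explore :: "real \<Rightarrow> nat \<Rightarrow> real" where
  "explore t l =
     (if l = 0 then min t (7/10) + max 0 (min t (14/10) - 13/10) + max 0 (min t 2 - 18/10)
      else if l = 1 then max 0 (min t (13/10) - 7/10) + max 0 (min t (18/10) - 14/10)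
      else 0)"

definition arrival :: "nat \<Rightarrow> real \<Rightarrow> real" where
  "arrival i x =
     (if i = 0 then (if x \<le> 7/10 then x else if x \<le> 8/10 then x + 6/10 else x + 1)
      else if i = 1 then (if x \<le> 6/10 then x + 7/10 else x + 8/10)
      else 3)"

text \<open>
  Once a nut has been found at depth \<open>x\<close>, the other nut of an extremal placement is at depth \<open>1\<close> in
  the same hole or at depth \<open>1 - x\<close> in another one. The budget rarely suffices for all of these;
  \<open>s\<close> decides whether the same hole takes precedence (in some of the cases where there is a choice).
\<close>

definition final_depths :: "bool \<Rightarrow> nat \<Rightarrow> real \<Rightarrow> real list" where
  "final_depths s i x =
     (if i = 0 then
        if x < 4/10 then (if s then [1, 1 - x, 0, 0] else [x, 1 - x, 1 - x, 0])
        else if x < 6/10 then (if s then [1, 1 - x, 1 - x, 0] else [x, 1 - x, 1 - x, 1 - x])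
        else if x \<le> 7/10 then [1, 1 - x, 1 - x, 1 - x]
        else if x \<le> 8/10 then [1, 6/10, 1 - x, 1 - x]
        else if x < 9/10 then (if s then [1, 1, 1 - x, 0] else [x, 1, 1 - x, 1 - x])
        else [1, 1, 1 - x, 1 - x]
      else
        if x < 5/10 then [max (1 - x) (7/10), 1, 0, 0]
        else if x \<le> 6/10 then [7/10, 1, 1 - x, 0]
        else if x < 8/10 then (if s then [8/10, 1, 1 - x, 0] else [8/10, x, 1 - x, 1 - x])
        else [8/10, 1, 1 - x, 1 - x])"

definition final_depth :: "bool \<Rightarrow> nat \<Rightarrow> real \<Rightarrow> nat \<Rightarrow> real" where
  "final_depth s i x l = (if l < 4 then final_depths s i x ! l else 0)"

lemma explore_digging: "digging 4 h explore"
  unfolding digging_def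
proof (intro conjI allI impI)
  fix s t :: real assume "s \<le> t"
  then show "(\<Sum>i<4. explore t i - explore s i) \<le> t - s"
    by (simp add: sum_lessThan_4 explore_def) (simp add: min_def max_def)
  show "explore s i \<le> explore t i" for i
    using \<open>s \<le> t\<close> by (simp add: explore_def) (simp add: min_def max_def)
qed (simp add: explore_def)

text \<open>On the explored holes \<open>arrival\<close> inverts the path; \<open>t < 3\<close>
  keeps the placeholder value out of reach.\<close>

lemma arrival_le_iff:
  assumes "0 < x" "x \<le> 1" "0 \<le> t" "t < 3"
  shows "x \<le> explore t i \<longleftrightarrow> arrival i x \<le> t"
proof -
  consider "i = 0" | "i = 1" | "i \<ge> 2" by linarith
  then show ?thesis
  proof cases
    case 1 then show ?thesis using assms by (auto simp: explore_def arrival_def min_def max_def)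
  next
    case 2 then show ?thesis using assms by (auto simp: explore_def arrival_def min_def max_def)
  next
    case 3 then show ?thesis using assms by (simp add: explore_def arrival_def)
  qed
qed

lemma explore_arrival_0:
  assumes "0 < x" "x \<le> 1"
  shows "explore (arrival 0 x) 0 = x"
    "explore (arrival 0 x) (Suc 0) = (if x \<le> 7/10 then 0 else if x \<le> 8/10 then 6/10 else 1)"
  using assms by (simp_all add: explore_def arrival_def min_def max_def)

lemma explore_arrival_1:
  assumes "0 < x" "x \<le> 1"
  shows "explore (arrival (Suc 0) x) 0 = (if x \<le> 6/10 then 7/10 else 8/10)"
    "explore (arrival (Suc 0) x) (Suc 0) = x"
  using assms by (simp_all add: explore_def arrival_def min_def max_def)

lemma explore_other: "2 \<le> l \<Longrightarrow> explore t l = 0"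
  by (simp add: explore_def)

lemma arrival_lt_3: "\<lbrakk>arrival i x < 3; x \<le> 1\<rbrakk> \<Longrightarrow> i = 0 \<or> i = 1"
  by (auto simp: arrival_def split: if_splits)

lemma final_depth_nth [simp]:
  "final_depth s i x 0 = final_depths s i x ! 0" "final_depth s i x (Suc 0) = final_depths s i x ! 1"
  "final_depth s i x 2 = final_depths s i x ! 2" "final_depth s i x 3 = final_depths s i x ! 3"
  by (simp_all add: final_depth_def)

lemma final_depth_ge:
  assumes "0 < x" "x \<le> 1" "arrival i x < 3" "l < 4"
  shows "explore (arrival i x) l \<le> final_depth s i x l"
proof -
  have l: "l = 0 \<or> l = 1 \<or> l = 2 \<or> l = 3" using assms by linarith
  from arrival_lt_3[OF assms(3,2)] show ?thesis
  proof
    assume "i = 0"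
    with l assms show ?thesis
      by (elim disjE) (auto simp: explore_arrival_0 explore_other final_depths_def)
  next
    assume "i = 1"
    with l assms show ?thesis
      by (elim disjE) (auto simp: explore_arrival_1 explore_other final_depths_def max_def)
  qed
qed

text \<open>The explored depths add up to the arrival time, so each list in
  \<open>final_depths\<close> has to sum to at most \<open>11/5\<close>, the smallest admissible
  \<open>h\<close>. Several thresholds there are the points where a list exhausts this
  budget.\<close>

lemma final_depth_sum:
  assumes "0 < x" "x \<le> 1" "arrival i x < 3"
  shows "(\<Sum>l<4. final_depth s i x l - explore (arrival i x) l) \<le> 11/5 - arrival i x"
  using arrival_lt_3[OF assms(3,2)]
proof
  assume "i = 0"
  with assms show ?thesis
    by (simp add: sum_lessThan_4 explore_arrival_0 explore_other final_depths_def)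
      (auto simp: arrival_def max_def)
next
  assume "i = 1"
  with assms show ?thesis
    by (simp add: sum_lessThan_4 explore_arrival_1 explore_other final_depths_def)
      (auto simp: arrival_def max_def)
qed

text \<open>The path digs one hole at a time, so its stages have disjoint ranges of arrival
  times.\<close>

lemma arrival_inj:
  assumes "arrival i x = arrival j y" "arrival i x < 3" "0 < x" "x \<le> 1" "0 < y" "y \<le> 1"
  shows "i = j \<and> x = y"
proof -
  have "i = 0 \<or> i = 1" "j = 0 \<or> j = 1"
    using arrival_lt_3[of i x] arrival_lt_3[of j y] assms by auto
  with assms show ?thesis
    by (elim disjE) (auto simp: arrival_def split: if_splits)
qed

definition searcher :: "real \<Rightarrow> bool \<Rightarrow> (nat \<Rightarrow> nat) \<Rightarrow> strategy" where
  "searcher h s \<pi> = explore_react (\<lambda>t l. explore t (\<pi> l)) (\<lambda>p. arrival (\<pi> (fst p)) (snd p))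
     (\<lambda>p l. final_depth s (\<pi> (fst p)) (snd p) (\<pi> l)) h"

text \<open>A winning test in the coordinates of the path that mentions neither strategies nor
  \<open>h\<close>, so that counting wins is linear arithmetic.\<close>

definition beats :: "bool \<Rightarrow> nat \<Rightarrow> real \<Rightarrow> nat \<Rightarrow> real \<Rightarrow> bool" where
  "beats s a x b y \<longleftrightarrow>
     (if arrival a x \<le> arrival b y
      then arrival a x < 3 \<and> x \<le> final_depth s a x a \<and> y \<le> final_depth s a x b
      else arrival b y < 3 \<and> x \<le> final_depth s b y a \<and> y \<le> final_depth s b y b)"

context
  fixes h :: real and \<pi> :: "nat \<Rightarrow> nat"
  assumes h: "11/5 \<le> h" "h < 9/4" and \<pi>: "bij_betw \<pi> {..<4} {..<4}"
begin

lemma relabel_lt: "l < 4 \<Longrightarrow> \<pi> l < 4"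
  using bij_betwE[OF \<pi>] by simp

lemma relabel_inj: "\<lbrakk>\<pi> i = \<pi> j; i < 4; j < 4\<rbrakk> \<Longrightarrow> i = j"
  using \<pi> by (auto simp: bij_betw_def inj_on_def)

lemma relabel_sum: "(\<Sum>l<4. F (\<pi> l)) = (\<Sum>l<4. F l)"
  by (rule sum.reindex_bij_betw[OF \<pi>])

text \<open>Exploration ends by time 2, strictly before \<open>11/5\<close>, which leaves time to
  react to every find.\<close>

lemma arrival_le_2: "\<lbrakk>arrival i x < 3; x \<le> 1\<rbrakk> \<Longrightarrow> arrival i x \<le> 2"
  by (auto simp: arrival_def split: if_splits)

lemma searcher_strategy: "searcher h s \<pi> \<in> strategies 2 4 h"
  and wins_searcher: "\<lbrakk>P \<in> placements 2 4; beats s (\<pi> (fst (P 0))) (snd (P 0)) (\<pi> (fst (P 1))) (snd (P 1))\<rbrakk>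
    \<Longrightarrow> wins 2 2 h (searcher h s \<pi>) P"
proof -
  let ?E = "\<lambda>t l. explore t (\<pi> l)" and ?T = "\<lambda>p. arrival (\<pi> (fst p)) (snd p)"
    and ?e = "\<lambda>p l. final_depth s (\<pi> (fst p)) (snd p) (\<pi> l)"
  have E: "digging 4 h ?E"
    using explore_digging[of h] relabel_lt relabel_sum[of "\<lambda>l. explore t l - explore u l" for t u]
    by (simp add: digging_def)
  have reach: "snd p \<le> ?E t (fst p) \<longleftrightarrow> ?T p \<le> t" if "p \<in> nut_locations 4" "0 \<le> t" "t \<le> h" for p t
    using that h by (intro arrival_le_iff) (auto simp: nut_locations_def)
  have T_nonneg: "0 \<le> ?T p" if "p \<in> nut_locations 4" for p
    using that by (auto simp: nut_locations_def arrival_def)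
  have T_less: "?T p < h" if "p \<in> nut_locations 4" "?T p \<le> h" for p
    using that h arrival_le_2[of "\<pi> (fst p)" "snd p"] by (auto simp: nut_locations_def)
  have T_inj: "p = q" if "p \<in> nut_locations 4" "q \<in> nut_locations 4" "?T p = ?T q" "?T p \<le> h" for p q
    using that h arrival_inj[of "\<pi> (fst p)" "snd p" "\<pi> (fst q)" "snd q"] relabel_inj[of "fst p" "fst q"]
    by (auto simp: nut_locations_def prod_eq_iff)
  have e_ge: "?E (?T p) l \<le> ?e p l" if "p \<in> nut_locations 4" "?T p \<le> h" "l < 4" for p l
    using that h relabel_lt by (intro final_depth_ge) (auto simp: nut_locations_def)
  have e_sum: "(\<Sum>l<4. ?e p l - ?E (?T p) l) \<le> h - ?T p" if "p \<in> nut_locations 4" "?T p \<le> h" for p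
    using final_depth_sum[of "snd p" "\<pi> (fst p)" s] that h
      relabel_sum[of "\<lambda>l. final_depth s (\<pi> (fst p)) (snd p) l - explore (?T p) l"]
    by (auto simp: nut_locations_def)
  note ax = E reach T_nonneg T_less T_inj e_ge e_sum
  show "searcher h s \<pi> \<in> strategies 2 4 h"
    unfolding searcher_def by (rule explore_react_strategy[OF ax])
  show "wins 2 2 h (searcher h s \<pi>) P"
    if P: "P \<in> placements 2 4" and "beats s (\<pi> (fst (P 0))) (snd (P 0)) (\<pi> (fst (P 1))) (snd (P 1))"
    unfolding searcher_def
  proof (rule wins_explore_react[OF ax P])
    have "snd (P 0) \<le> 1" "snd (P 1) \<le> 1"
      using placements_two_locations[OF P] by (auto simp: nut_locations_def)
    then show "?T (first_nut ?T P) \<le> h" 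
      using that(2) arrival_le_2[of "\<pi> (fst (P 0))" "snd (P 0)"] arrival_le_2[of "\<pi> (fst (P 1))" "snd (P 1)"] h
      by (auto simp: beats_def first_nut_def split: if_splits)
  qed (use that(2) in \<open>auto simp: beats_def first_nut_def split: if_splits\<close>)
qed

lemma searcher_pure: "searcher h s \<pi> \<in> pure_searches 2 2 4 h"
proof -
  have "(\<lambda>p. arrival (\<pi> (fst p)) (snd p)) \<in> borel_measurable borel"
    by (intro borel_measurable_nat_times_real) (simp add: arrival_def)
  moreover have "(\<lambda>p. final_depth s (\<pi> (fst p)) (snd p) (\<pi> l)) \<in> borel_measurable borel" for l
  proof (intro borel_measurable_nat_times_real)
    fix i
    have "\<pi> l = 0 \<or> \<pi> l = 1 \<or> \<pi> l = 2 \<or> \<pi> l = 3 \<or> \<not> \<pi> l < 4" by linarith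
    then show "(\<lambda>x. final_depth s (\<pi> (fst (i, x))) (snd (i, x)) (\<pi> l)) \<in> borel_measurable borel"
      by (elim disjE) (simp_all add: final_depth_def final_depths_def if_distrib[of "\<lambda>z. z ! _"] cong: if_cong)
  qed
  moreover have "(\<lambda>t. explore t (\<pi> l)) \<in> borel_measurable borel" for l
    by (simp add: explore_def)
  ultimately have "{P \<in> placements 2 4. wins 2 2 h (searcher h s \<pi>) P} \<in> sets (placement_space 2 4)"
    unfolding searcher_def by (rule explore_react_borel)
  then show ?thesis
    using searcher_strategy by (simp add: pure_searches_def)
qed

end

section \<open>Counting wins over relabellings\<close>

text \<open>
  The alternating group on the four holes is sharply 2-transitive, so twelve relabellings suffice to
  send each pair of distinct holes to every such pair equally often.
\<close>

definition even_perms :: "nat list list" where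
  "even_perms =
     [[0, 1, 2, 3], [0, 2, 3, 1], [0, 3, 1, 2], [1, 0, 3, 2], [1, 2, 0, 3], [1, 3, 2, 0],
      [2, 0, 1, 3], [2, 1, 3, 0], [2, 3, 0, 1], [3, 0, 2, 1], [3, 1, 0, 2], [3, 2, 1, 0]]"

lemma lessThan_4: "{..<4} = {0, 1, 2, 3 :: nat}"
  by auto

lemma lessThan_12: "{..<12} = {0, 1, 2, 3, 4, 5, 6, 7, 8, 9, 10, 11 :: nat}"
  by (auto; arith)

lemma even_perms_bij:
  assumes "r < 12"
  shows "bij_betw (nth (even_perms ! r)) {..<4} {..<4}"
proof -
  have "r \<in> {0, 1, 2, 3, 4, 5, 6, 7, 8, 9, 10, 11}" using assms lessThan_12 by blast
  then show ?thesis
    unfolding bij_betw_def lessThan_4 by (auto simp: even_perms_def)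
qed

lemma sum_even_perms_pair:
  fixes F :: "nat \<Rightarrow> nat \<Rightarrow> nat"
  assumes "i < 4" "l < 4" "i \<noteq> l"
  shows "(\<Sum>r<12. F (even_perms ! r ! i) (even_perms ! r ! l)) = (\<Sum>a<4. \<Sum>b<4. if a = b then 0 else F a b)"
proof -
  have "i \<in> {0, 1, 2, 3}" "l \<in> {0, 1, 2, 3}" using assms lessThan_4 by blast+
  then show ?thesis
    using assms(3) by (elim insertE emptyE) (simp_all add: lessThan_4 lessThan_12 even_perms_def)
qed

lemma sum_even_perms_single:
  fixes F :: "nat \<Rightarrow> nat"
  assumes "i < 4"
  shows "(\<Sum>r<12. F (even_perms ! r ! i)) = 3 * (\<Sum>a<4. F a)"
proof -
  have "i \<in> {0, 1, 2, 3}" using assms lessThan_4 by blast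
  then show ?thesis
    by (elim insertE emptyE) (simp_all add: lessThan_4 lessThan_12 even_perms_def)
qed

text \<open>The probabilities \<open>4/5\<close> and \<open>1/5\<close> as counts out of
  five.\<close>

definition hits :: "nat \<Rightarrow> real \<Rightarrow> nat \<Rightarrow> real \<Rightarrow> nat" where
  "hits a x b y = 4 * of_bool (beats True a x b y) + of_bool (beats False a x b y)"

text \<open>Twelve ordered pairs of holes times five make 60, and \<open>27/60 = 9/20\<close>. The
  comparisons in \<open>beats\<close> are settled by splitting the range of \<open>x\<close> at
  multiples of \<open>1/10\<close>.\<close>

lemma hits_pair:
  assumes "0 < x" "x < 1"
  shows "27 \<le> (\<Sum>a<4. \<Sum>b<4. if a = b then 0 else hits a x b (1 - x))"
proof -
  note defs = lessThan_4 hits_def beats_def arrival_def final_depths_def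
  consider "x < 3/10" | "3/10 \<le> x" "x < 5/10" | "x = 5/10" | "5/10 < x" "x \<le> 7/10" | "7/10 < x"
    by linarith
  then show ?thesis
  proof cases
    case 1
    then consider "x \<le> 1/10" | "1/10 < x" "x < 2/10" | "x = 2/10" | "2/10 < x" by linarith
    with 1 assms show ?thesis by cases (simp_all add: defs)
  next
    case 2
    then consider "x < 4/10" | "x = 4/10" | "4/10 < x" by linarith
    with 2 assms show ?thesis by cases (simp_all add: defs)
  next
    case 3
    then show ?thesis by (simp add: defs)
  next
    case 4
    then consider "x < 6/10" | "x = 6/10" | "6/10 < x" by linarith
    with 4 assms show ?thesis by cases (simp_all add: defs)
  next
    case 5
    then consider "x < 8/10" | "x = 8/10" | "8/10 < x" "x < 9/10" | "9/10 \<le> x" by linarith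
    with 5 assms show ?thesis by cases (simp_all add: defs)
  qed
qed

text \<open>For nuts in one hole, each target hole comes from three relabellings, so 9 yields the
  same 27. Either label may carry the nut at depth 1.\<close>

lemma hits_single:
  assumes "0 < x" "x \<le> 1"
  shows "9 \<le> (\<Sum>a<4. hits a x a 1)" "9 \<le> (\<Sum>a<4. hits a 1 a x)"
proof -
  consider "x < 4/10" | "4/10 \<le> x" "x < 5/10" | "5/10 \<le> x" "x < 6/10" | "x = 6/10"
    | "6/10 < x" "x \<le> 7/10" | "7/10 < x" "x < 8/10" | "x = 8/10" | "8/10 < x" "x < 9/10" | "9/10 \<le> x"
    by linarith
  then have "9 \<le> (\<Sum>a<4. hits a x a 1) \<and> 9 \<le> (\<Sum>a<4. hits a 1 a x)"
    using assms
    by cases (simp_all add: lessThan_4 hits_def beats_def arrival_def final_depths_def)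
  then show "9 \<le> (\<Sum>a<4. hits a x a 1)" "9 \<le> (\<Sum>a<4. hits a 1 a x)" by blast+
qed

lemma sum_hits_extremal:
  assumes "P \<in> extremal_placements 2 4"
  shows "27 \<le> (\<Sum>r<12. hits (even_perms ! r ! fst (P 0)) (snd (P 0)) (even_perms ! r ! fst (P 1)) (snd (P 1)))"
proof -
  have P: "fst (P 0) < 4" "fst (P 1) < 4" "0 < snd (P 0)" "0 < snd (P 1)" "total_depth 2 P = 1"
    using assms by (auto simp: extremal_placements_def placements_two_iff)
  show ?thesis
  proof (cases "fst (P 0) = fst (P 1)")
    case True
    have "max (snd (P 0)) (snd (P 1)) = 1" using P(5) True by (simp add: total_depth_two)
    then have "snd (P 0) = 1 \<and> snd (P 1) \<le> 1 \<or> snd (P 1) = 1 \<and> snd (P 0) \<le> 1"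
      by (auto simp: max_def split: if_splits)
    then have "9 \<le> (\<Sum>a<4. hits a (snd (P 0)) a (snd (P 1)))"
      using hits_single[of "snd (P 0)"] hits_single[of "snd (P 1)"] P by auto
    then show ?thesis
      using sum_even_perms_single[of "fst (P 1)" "\<lambda>a. hits a (snd (P 0)) a (snd (P 1))"] P True by simp
  next
    case False
    then have eq: "snd (P 1) = 1 - snd (P 0)" using P(5) by (simp add: total_depth_two)
    have "27 \<le> (\<Sum>a<4. \<Sum>b<4. if a = b then 0 else hits a (snd (P 0)) b (snd (P 1)))"
      unfolding eq using P(3,4) eq by (intro hits_pair) auto
    then show ?thesis
      using sum_even_perms_pair[OF P(1,2) False, of "\<lambda>a b. hits a (snd (P 0)) b (snd (P 1))"] by linarith
  qed
qed

lemma extremal_value_ge: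
  assumes h: "11/5 \<le> h" "h < 9/4"
  shows "9/20 \<le> value_sup_inf 2 2 4 h (extremal_placements 2 4)"
    "\<And>\<mu>. \<mu> \<in> mixed_hidings 2 4 (extremal_placements 2 4) \<Longrightarrow> 9/20 \<le> hiding_guarantee 2 2 4 h \<mu>"
    "9/20 \<le> value_inf_sup 2 2 4 h (extremal_placements 2 4)"
    "pure_searches 2 2 4 h \<noteq> {}" "mixed_searches 2 2 4 h \<noteq> {}"
proof -
  \<comment> \<open>The first component selects \<open>s\<close>, which is true for four of its five
    values; the second selects the relabelling.\<close>
  define I where "I = {..<5::nat} \<times> {..<12::nat}"
  define f where "f i = searcher h (fst i \<noteq> 0) (nth (even_perms ! snd i))" for i :: "nat \<times> nat"
  have I: "finite I" "I \<noteq> {}" "card I = 60" by (auto simp: I_def lessThan_empty_iff)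
  have f: "f ` I \<subseteq> pure_searches 2 2 4 h"
    using searcher_pure[OF h even_perms_bij] by (auto simp: f_def I_def)
  have X: "extremal_placements 2 4 \<noteq> {}" "extremal_placements 2 4 \<subseteq> placements 2 4"
  proof -
    have "(\<lambda>j\<in>{..<2}. (0, 1)) \<in> extremal_placements 2 4"
      by (simp add: extremal_placements_def placements_two_iff total_depth_two)
    then show "extremal_placements 2 4 \<noteq> {}" by blast
  qed (auto simp: extremal_placements_def)
  have count: "9/20 * real (card I) \<le> real (card {i \<in> I. wins 2 2 h (f i) P})"
    if P: "P \<in> extremal_placements 2 4" for P
  proof -
    define B where "B r u \<longleftrightarrow> beats (u \<noteq> 0) (even_perms ! r ! fst (P 0)) (snd (P 0)) (even_perms ! r ! fst (P 1)) (snd (P 1))"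
      for r u :: nat
    have B: "wins 2 2 h (f i) P" if "i \<in> I" "B (snd i) (fst i)" for i
      using that P X(2) unfolding f_def B_def
      by (intro wins_searcher[OF h even_perms_bij]) (auto simp: I_def)
    have u: "{..<5} = {0, 1, 2, 3, 4 :: nat}" by auto
    have "(\<Sum>u<5. of_bool (B r u)) = hits (even_perms ! r ! fst (P 0)) (snd (P 0)) (even_perms ! r ! fst (P 1)) (snd (P 1))" for r
      unfolding u by (simp add: hits_def B_def del: sum_of_bool_eq)
    then have "27 \<le> (\<Sum>r<12. \<Sum>u<5. of_bool (B r u) :: nat)"
      using sum_hits_extremal[OF P] by (simp only:)
    also have "\<dots> = (\<Sum>i\<in>I. of_bool (B (snd i) (fst i)))"
      unfolding I_def by (subst sum.swap) (simp only: sum.cartesian_product case_prod_unfold)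
    also have "\<dots> \<le> (\<Sum>i\<in>I. of_bool (wins 2 2 h (f i) P))"
      using B by (intro sum_mono) auto
    also have "\<dots> = card {i \<in> I. wins 2 2 h (f i) P}"
      using I by (auto intro!: arg_cong[of _ _ card])
    finally show ?thesis using I by simp
  qed
  note v = value_ge[OF I(1,2) f X count]
  show "9/20 \<le> value_sup_inf 2 2 4 h (extremal_placements 2 4)"
    "\<And>\<mu>. \<mu> \<in> mixed_hidings 2 4 (extremal_placements 2 4) \<Longrightarrow> 9/20 \<le> hiding_guarantee 2 2 4 h \<mu>"
    "9/20 \<le> value_inf_sup 2 2 4 h (extremal_placements 2 4)"
    using v by blast+
  show "pure_searches 2 2 4 h \<noteq> {}" using f I by auto
  show "mixed_searches 2 2 4 h \<noteq> {}" using mixed_searches_distr[OF I(1,2) f] by auto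
qed

section \<open>Comparison of the values\<close>

lemma sum_marks_weight: "(\<Sum>m\<in>marks. \<Sum>m'\<in>marks. mark_weight m m') = 100"
proof -
  have s: "(\<Sum>m\<in>marks. F m) = (\<Sum>i<4. F (i, 1) + F (i, 2) + F (i, 3) + F (i, 4))" for F :: "nat \<times> nat \<Rightarrow> nat"
  proof -
    have "(\<Sum>b\<in>{1..4}. F (i, b)) = F (i, 1) + F (i, 2) + F (i, 3) + F (i, 4)" for i
      by (simp add: eval_nat_numeral)
    moreover have "(\<Sum>m\<in>marks. F m) = (\<Sum>i<4. \<Sum>b\<in>{1..4}. F (i, b))"
      unfolding marks_def by (simp add: sum.cartesian_product)
    ultimately show ?thesis by (simp only:)
  qed
  show ?thesis
    unfolding s by (simp add: sum_lessThan_4 mark_weight_def weight_same_def weight_apart_def)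
qed

lemma value_placements_le:
  assumes h: "0 < h" "h < 9/4" and ne: "mixed_searches 2 2 4 h \<noteq> {}" "pure_searches 2 2 4 h \<noteq> {}"
  shows "value_sup_inf 2 2 4 h (placements 2 4) \<le> 11/25" "value_inf_sup 2 2 4 h (placements 2 4) \<le> 11/25"
proof -
  \<comment> \<open>Each ordered pair of marks is repeated according to its weight; there are 100
    indices, and \<open>44/100 = 11/25\<close>.\<close>
  define I where "I = (SIGMA p:marks \<times> marks. {..<mark_weight (fst p) (snd p)})"
  define g where "g i = mark_placement (fst (fst i)) (snd (fst i))" for i :: "((nat \<times> nat) \<times> (nat \<times> nat)) \<times> nat"
  have fin: "finite I" by (simp add: I_def)
  have card: "card {i \<in> I. Q (fst i)} = (\<Sum>m\<in>marks. \<Sum>m'\<in>marks. if Q (m, m') then mark_weight m m' else 0)" for Q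
  proof -
    have "{i \<in> I. Q (fst i)} = (SIGMA p:marks \<times> marks. if Q p then {..<mark_weight (fst p) (snd p)} else {})"
      by (auto simp: I_def split: if_splits)
    also have "card \<dots> = (\<Sum>p\<in>marks \<times> marks. if Q p then mark_weight (fst p) (snd p) else 0)"
      by (subst card_SigmaI) (auto intro!: sum.cong)
    finally show ?thesis by (simp add: sum.cartesian_product case_prod_beta)
  qed
  have cI: "card I = 100" using card[of "\<lambda>_. True"] by (simp add: sum_marks_weight)
  then have ne': "I \<noteq> {}" by auto
  have g: "g ` I \<subseteq> placements 2 4"
    by (auto simp: I_def g_def intro!: mark_placement_in_placements)
  have a: "real (card {i \<in> I. wins 2 2 h S (g i)}) \<le> 11/25 * real (card I)" if "S \<in> strategies 2 4 h" for S
  proof -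
    have "card {i \<in> I. wins 2 2 h S (g i)} \<le> 44"
      using strategy_weight_bound[OF that h] card[of "\<lambda>p. wins 2 2 h S (mark_placement (fst p) (snd p))"]
      by (simp add: g_def)
    then show ?thesis by (simp add: cI)
  qed
  show "value_sup_inf 2 2 4 h (placements 2 4) \<le> 11/25" "value_inf_sup 2 2 4 h (placements 2 4) \<le> 11/25"
    using value_le[OF fin ne' g ne a] by blast+
qed

theorem corollary2p12:
  "infinite {(k :: nat, j :: nat, n :: nat, h :: real).
     1 \<le> j \<and> j \<le> k \<and> 1 \<le> n \<and> 0 < h \<and>
     value_sup_inf k j n h (placements k n) \<noteq> value_sup_inf k j n h (extremal_placements k n) \<and>
     value_inf_sup k j n h (placements k n) \<noteq> value_inf_sup k j n h (extremal_placements k n) \<and>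
     \<not> (\<exists>\<mu> \<in> mixed_hidings k n (extremal_placements k n). optimal_hiding k j n h \<mu>)}"
    (is "infinite ?A")
proof
  assume "finite ?A"
  have "(2, 2, 4, h) \<in> ?A" if "h \<in> {11/5..<9/4}" for h
  proof -
    have h: "11/5 \<le> h" "h < 9/4" "0 < h" using that by auto
    note ge = extremal_value_ge[OF h(1,2)]
    note le = value_placements_le[OF h(3,2) ge(5,4)]
    \<comment> \<open>An optimal \<open>\<mu>\<close> would guarantee at most \<open>11/25\<close>,
      but an extremal one concedes at least \<open>9/20\<close>.\<close>
    have "\<not> optimal_hiding 2 2 4 h \<mu>" if "\<mu> \<in> mixed_hidings 2 4 (extremal_placements 2 4)" for \<mu>
      using ge(2)[OF that] le(2) by (auto simp: optimal_hiding_def)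
    then show ?thesis using ge(1,3) le h(3) by auto
  qed
  then have "(\<lambda>h. (2, 2, 4, h)) ` {11/5..<9/4} \<subseteq> ?A" by blast
  then have "finite ((\<lambda>h :: real. (2 :: nat, 2 :: nat, 4 :: nat, h)) ` {11/5..<9/4})"
    using \<open>finite ?A\<close> by (rule finite_subset)
  then have "finite {11/5..<9/4 :: real}"
    by (rule finite_imageD) (auto simp: inj_on_def)
  then show False using infinite_Ico[of "11/5" "9/4 :: real"] by simp
qed

end
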